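(* There exists a recursive subshift $X \subset \{0,1,2,3\}^{\mathbb{Z}}$ which is contained in a countable SFT, has finitely many minimal subsystems, and has a $\Sigma^0_1$-complete halting problem. Moreover, every minimal subsystem of $X$ consists of a single unary point, i.e. is of the form $\{a^{\mathbb{Z}}\}$ for some symbol $a$.
   Context: For a finite alphabet $S$, give $S^{\mathbb{Z}}$ the product topology and the shift $\sigma(x)_i = x_{i+1}$. A subshift is a closed set $X \subset S^{\mathbb{Z}}$ with $\sigma(X)=X$; a subsystem of $X$ is a subshift $Y\subset X$; a minimal subsystem is a nonempty subsystem whose only subshifts are $\emptyset$ and itself. An SFT is a subshift consisting of all points of $S^{\mathbb{Z}}$ containing no word from some fixed finite set of forbidden words. The language $\mathcal{L}(X)$ is the set of finite words occurring as contiguous subwords of points of $X$; $X$ is recursive if $\mathcal{L}(X)$ is recursive. The point $a^{\mathbb{Z}}$ is the point $x$ with $x_i=a$ for all $i\in\mathbb{Z}$. For a finite set $C$ of words of a common length $n$, $[C]$ is the clopen set of points $x$ with $x_{[0,n-1]} \in C$; clopen sets are given in such a finite form (up to a shift of coordinates). The halting problem for $X$ is: given clopen sets $[C],[D]$, decide whether there exist $x \in X$ and $j \in \mathbb{N}=\{0,1,2,\dots\}$ with $x \in [C]$ and $\sigma^j(x) \in [D]$. Completeness is under many-one reductions. *)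

theory Defs
  imports "HOL-Analysis.Analysis" "HOL-Library.Nat_Bijection" "HOL-Library.Countable_Set"
begin

section \<open>Computability\<close>

text \<open>
  Kleene's partial recursive functions. Arities are not tracked: a program is run on an argument
  list of any length. The recursion variable of \<open>PrimRec\<close> and the search variable of \<open>Mu\<close> come
  first in the argument list.
\<close>

datatype recf = Zero | Succ | Proj nat | Comp recf "recf list" | PrimRec recf recf | Mu recf

text \<open>\<open>computes f xs v\<close>: the program \<open>f\<close> halts on the arguments \<open>xs\<close> with value \<open>v\<close>.\<close>

inductive computes :: "recf \<Rightarrow> nat list \<Rightarrow> nat \<Rightarrow> bool" where
  "computes Zero xs 0"
| "computes Succ (x # xs) (Suc x)"
| "i < length xs \<Longrightarrow> computes (Proj i) xs (xs ! i)"
| "list_all2 (\<lambda>g y. computes g xs y) gs ys \<Longrightarrow> computes f ys v \<Longrightarrow> computes (Comp f gs) xs v"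
| "computes f xs v \<Longrightarrow> computes (PrimRec f g) (0 # xs) v"
| "computes (PrimRec f g) (n # xs) u \<Longrightarrow> computes g (n # u # xs) v
    \<Longrightarrow> computes (PrimRec f g) (Suc n # xs) v"
| "computes f (n # xs) 0 \<Longrightarrow> (\<forall>m<n. \<exists>k. computes f (m # xs) (Suc k)) \<Longrightarrow> computes (Mu f) xs n"

lemma computes_deterministic: "computes f xs v \<Longrightarrow> computes f xs w \<Longrightarrow> v = w"
proof (induction arbitrary: w rule: computes.induct)
  case (1 xs)
  then show ?case by cases simp_all
next
  case (2 x xs)
  then show ?case by cases simp_all
next
  case (3 i xs)
  from "3.prems" show ?case by cases simp_all
next
  case (4 xs gs ys f v)
  from "4.prems" obtain zs where "list_all2 (\<lambda>g y. computes g xs y) gs zs" "computes f zs w"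
    by cases
  moreover from this(1) have "ys = zs"
    using "4.hyps"(1) "4.IH"(1) by (intro nth_equalityI) (auto simp: list_all2_conv_all_nth)
  ultimately show ?case using "4.IH" by blast
next
  case (5 f xs v g)
  from "5.prems" show ?case by cases (rule "5.IH")
next
  case (6 f g n xs u v)
  from "6.prems" obtain u' where "computes (PrimRec f g) (n # xs) u'" "computes g (n # u' # xs) w"
    by cases
  with "6.IH" show ?case by blast
next
  case (7 f n xs)
  from "7.prems" have w: "computes f (w # xs) 0" "\<forall>m<w. \<exists>k. computes f (m # xs) (Suc k)"
    by (auto elim: computes.cases)
  show ?case
  proof (rule linorder_cases[of n w])
    assume "n < w"
    with w(2) obtain k where "computes f (n # xs) (Suc k)" by blast
    from "7.IH"(1)[OF this] show ?thesis by simp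
  next
    assume "w < n"
    with "7.IH"(2) obtain k where "\<And>v. computes f (w # xs) v \<Longrightarrow> Suc k = v" by blast
    from this[OF w(1)] show ?thesis by simp
  qed
qed

definition total_recursive :: "(nat \<Rightarrow> nat) \<Rightarrow> bool" where
  "total_recursive f \<longleftrightarrow> (\<exists>r. \<forall>x. computes r [x] (f x))"

definition recursive_set :: "nat set \<Rightarrow> bool" where
  "recursive_set A \<longleftrightarrow> (\<exists>r. \<forall>x. computes r [x] (if x \<in> A then 1 else 0))"

definition recursive_relation :: "(nat \<Rightarrow> nat \<Rightarrow> bool) \<Rightarrow> bool" where
  "recursive_relation R \<longleftrightarrow> (\<exists>r. \<forall>x y. computes r [x, y] (if R x y then 1 else 0))"

definition sigma01 :: "nat set \<Rightarrow> bool" where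
  "sigma01 A \<longleftrightarrow> (\<exists>R. recursive_relation R \<and> A = {x. \<exists>y. R x y})"

definition many_one_reducible :: "nat set \<Rightarrow> nat set \<Rightarrow> bool" where
  "many_one_reducible A B \<longleftrightarrow> (\<exists>f. total_recursive f \<and> (\<forall>x. x \<in> A \<longleftrightarrow> f x \<in> B))"

definition sigma01_complete :: "nat set \<Rightarrow> bool" where
  "sigma01_complete B \<longleftrightarrow> sigma01 B \<and> (\<forall>A. sigma01 A \<longrightarrow> many_one_reducible A B)"

section \<open>Subshifts\<close>

definition full_shift :: "'a set \<Rightarrow> (int \<Rightarrow> 'a) topology" where
  "full_shift S = product_topology (\<lambda>_. discrete_topology S) UNIV"

definition shift :: "(int \<Rightarrow> 'a) \<Rightarrow> int \<Rightarrow> 'a" where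
  "shift x = (\<lambda>i. x (i + 1))"

definition subshift :: "'a set \<Rightarrow> (int \<Rightarrow> 'a) set \<Rightarrow> bool" where
  "subshift S X \<longleftrightarrow> closedin (full_shift S) X \<and> shift ` X = X"

definition minimal_subsystem :: "'a set \<Rightarrow> (int \<Rightarrow> 'a) set \<Rightarrow> (int \<Rightarrow> 'a) set \<Rightarrow> bool" where
  "minimal_subsystem S X Y \<longleftrightarrow> subshift S Y \<and> Y \<subseteq> X \<and> Y \<noteq> {} \<and>
     (\<forall>Z. subshift S Z \<and> Z \<subseteq> Y \<longrightarrow> Z = {} \<or> Z = Y)"

text \<open>The word of length \<open>n\<close> occurring in \<open>x\<close> at coordinate \<open>i\<close>.\<close>

definition block :: "(int \<Rightarrow> 'a) \<Rightarrow> int \<Rightarrow> nat \<Rightarrow> 'a list" where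
  "block x i n = map (\<lambda>k. x (i + int k)) [0..<n]"

definition occurs_in :: "'a list \<Rightarrow> (int \<Rightarrow> 'a) \<Rightarrow> bool" where
  "occurs_in w x \<longleftrightarrow> (\<exists>i. block x i (length w) = w)"

definition SFT :: "'a set \<Rightarrow> (int \<Rightarrow> 'a) set \<Rightarrow> bool" where
  "SFT S X \<longleftrightarrow> subshift S X \<and>
     (\<exists>F. finite F \<and> F \<subseteq> lists S \<and>
          X = {x \<in> topspace (full_shift S). \<forall>w\<in>F. \<not> occurs_in w x})"

definition language :: "(int \<Rightarrow> 'a) set \<Rightarrow> 'a list set" where
  "language X = {w. \<exists>x\<in>X. occurs_in w x}"

definition recursive_subshift :: "nat set \<Rightarrow> (int \<Rightarrow> nat) set \<Rightarrow> bool" where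
  "recursive_subshift S X \<longleftrightarrow> subshift S X \<and> recursive_set (list_encode ` language X)"

definition unary_point :: "'a \<Rightarrow> int \<Rightarrow> 'a" where
  "unary_point a = (\<lambda>_. a)"

section \<open>The halting problem\<close>

text \<open>
  Two-sided clopen sets need not start at coordinate 0, so a clopen set is presented by an offset
  \<open>k\<close> and a finite set \<open>C\<close> of words of a common length \<open>n\<close>; the case \<open>k = 0\<close> is \<open>[C]\<close>.
\<close>

definition clopen :: "'a set \<Rightarrow> int \<Rightarrow> nat \<Rightarrow> 'a list set \<Rightarrow> (int \<Rightarrow> 'a) set" where
  "clopen S k n C = {x \<in> topspace (full_shift S). block x k n \<in> C}"

text \<open>
  As input data the set of words is listed, in any order and with repetitions allowed. The length
  \<open>n\<close> need not be coded: the words determine it, unless there are none, and then the clopen set is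
  empty whatever \<open>n\<close> is.
\<close>

definition clopen_code :: "int \<Rightarrow> nat list list \<Rightarrow> nat" where
  "clopen_code k ws = prod_encode (int_encode k, list_encode (map list_encode ws))"

text \<open>Numbers which code no pair of clopen sets are counted as negative instances.\<close>

definition halting_problem :: "nat set \<Rightarrow> (int \<Rightarrow> nat) set \<Rightarrow> nat set" where
  "halting_problem S X =
     {prod_encode (clopen_code k C, clopen_code l D) | k C l D.
        \<exists>m n. set C \<subseteq> {w \<in> lists S. length w = m} \<and> set D \<subseteq> {w \<in> lists S. length w = n} \<and>
          (\<exists>x\<in>X. \<exists>j::nat. x \<in> clopen S k m (set C) \<and> (shift ^^ j) x \<in> clopen S l n (set D))}"

end

theory Submission imports Defs begin

text \<open>
  The countable SFT does no computation at all: it consists of the nondecreasing points over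
  \<open>0 < 1 < 2 < 3\<close>, which are given by forbidding the finitely many two-letter words with a
  descent, and of which there are only countably many. The recursively enumerable information is put
  into the subshift \<open>X\<close> inside it, which merely has to be recursive. Let \<open>R\<close> be a
  decidable relation such that \<open>{m. \<exists>n. R m n}\<close> is complete. A point with both letters
  \<open>0\<close> and \<open>3\<close> is a translate of \<open>\<dots>0 0 1\<^sup>m 2\<^sup>n 3 3\<dots>\<close>, and \<open>X\<close> keeps
  it only if \<open>R m (n - 1)\<close> holds.

  The language of \<open>X\<close> is decidable because a nondecreasing word not containing both \<open>0\<close> and
  \<open>3\<close> always extends, by repeating its end letters, to a point on which \<open>R\<close> imposes nothing;
  the other words determine \<open>m\<close> and \<open>n\<close>, so that one query to \<open>R\<close> settles them
  (\<open>language_avoiding\<close>, \<open>language_relation_shift\<close>). In particular, \<open>0 1\<^sup>m 2\<close>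
  is in the language for every \<open>m\<close>, but a point that starts with it meets a \<open>3\<close> later
  on if and only if \<open>R m n\<close> holds for some \<open>n\<close>. This reduces \<open>{m. \<exists>n. R m n}\<close>
  to the halting problem (\<open>halting_problem_reduction\<close>). Conversely, two visits to clopen sets
  are witnessed by a single word of the recursive language, so that the halting problem is recursively
  enumerable (\<open>visits_iff_subwords\<close>, \<open>sigma01_halting_problem\<close>). Finally, the shifts of
  a nondecreasing point converge to a unary point, so that every nonempty subsystem contains one
  (\<open>unary_point_in_subshift\<close>) and the minimal subsystems are singletons.

  All of this rests on two pieces of computability theory. One is a calculus of closure properties
  by which computability, decidability and semidecidability of a predicate are read off from the
  formula that defines it. The other is the existence of a complete recursively enumerable set: a
  computation of a program is a derivation in the inductive definition of \<open>computes\<close>, a derivation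
  is a finite list of judgements, and checking a coded list is again a formula of that calculus
  (\<open>derivable_iff_computes\<close>, \<open>semidecidable_derivable\<close>).
\<close>

section \<open>Computable functions of an environment\<close>

text \<open>
  Functions of several variables are represented as functions of an environment
  \<open>e :: nat \<Rightarrow> nat\<close>, in which variable \<open>i\<close> has the value \<open>e i\<close>. A binder pushes the
  new variable in front, so that the old environment becomes \<open>\<lambda>i. e (Suc i)\<close>. In this
  form every closure property below is an introduction rule which resolution can apply to the
  body of an ordinary HOL term, and no arities have to be tracked: a program can see only finitely
  many variables, which is why some \<open>n\<close> exists for it.
\<close>

definition computable :: "((nat \<Rightarrow> nat) \<Rightarrow> nat) \<Rightarrow> bool" where
  "computable F \<longleftrightarrow> (\<exists>n r. \<forall>e. computes r (map e [0..<n]) (F e))"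

lemma computes_Comp_map:
  assumes "\<And>i. i < n \<Longrightarrow> computes (s i) xs (a i)" and "computes r (map a [0..<n]) v"
  shows "computes (Comp r (map s [0..<n])) xs v"
  using assms
  by (intro computes.intros(4)[where ys = "map a [0..<n]"]) (auto simp: list_all2_conv_all_nth)

lemma computable_arity:
  assumes "computable F"
  shows "\<exists>n. \<forall>m\<ge>n. \<exists>r. \<forall>e. computes r (map e [0..<m]) (F e)"
proof -
  obtain n r where r: "\<And>e. computes r (map e [0..<n]) (F e)"
    using assms unfolding computable_def by blast
  have "computes (Comp r (map Proj [0..<n])) (map e [0..<m]) (F e)" if "m \<ge> n" for m e
  proof (rule computes_Comp_map)
    show "computes (Proj i) (map e [0..<m]) (e i)" if "i < n" for i
      using computes.intros(3)[of i "map e [0..<m]"] \<open>i < n\<close> \<open>m \<ge> n\<close> by simp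
  qed (rule r)
  then show ?thesis by blast
qed

lemma computable_subst:
  assumes "computable F" and A: "\<And>i. computable (A i)"
  shows "computable (\<lambda>e. F (\<lambda>i. A i e))"
proof -
  obtain n r where r: "\<And>e. computes r (map e [0..<n]) (F e)"
    using assms(1) unfolding computable_def by blast
  have "\<forall>i. \<exists>n. \<forall>m\<ge>n. \<exists>s. \<forall>e. computes s (map e [0..<m]) (A i e)"
    using computable_arity[OF A] by blast
  then obtain k where k: "\<And>i m. m \<ge> k i \<Longrightarrow> \<exists>s. \<forall>e. computes s (map e [0..<m]) (A i e)"
    by metis
  define M where "M = (\<Sum>i<n. k i)"
  have "\<forall>i. \<exists>s. i < n \<longrightarrow> (\<forall>e. computes s (map e [0..<M]) (A i e))"
    using k[of _ M] by (metis M_def finite_lessThan lessThan_iff member_le_sum zero_le)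
  then obtain s where s: "\<And>i e. i < n \<Longrightarrow> computes (s i) (map e [0..<M]) (A i e)"
    by metis
  have "computes (Comp r (map s [0..<n])) (map e [0..<M]) (F (\<lambda>i. A i e))" for e
    by (rule computes_Comp_map[where a = "\<lambda>i. A i e"]) (use s r in auto)
  then show ?thesis unfolding computable_def by blast
qed

lemma map_case_nat_upt: "map (case_nat x e) [0..<Suc n] = x # map e [0..<n]"
proof -
  have "[0..<Suc n] = 0 # map Suc [0..<n]" by (simp add: map_Suc_upt upt_conv_Cons)
  then show ?thesis by (simp add: comp_def)
qed

lemma computable_var: "computable (\<lambda>e. e i)"
proof -
  have "computes (Proj i) (map e [0..<Suc i]) (e i)" for e
    using computes.intros(3)[of i "map e [0..<Suc i]"] by (simp add: nth_append)
  then show ?thesis unfolding computable_def by blast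
qed

lemma computable_Suc:
  assumes "computable A" shows "computable (\<lambda>e. Suc (A e))"
proof -
  have "computes Succ (map e [0..<Suc 0]) (Suc (e 0))" for e
    using computes.intros(2)[of "e 0" "[]"] by simp
  then have "computable (\<lambda>e. Suc (e 0))" unfolding computable_def by blast
  from computable_subst[OF this, of "\<lambda>_. A"] assms show ?thesis by simp
qed

lemma computable_const: "computable (\<lambda>e. c)"
proof (induction c)
  case 0
  have "computes Zero (map e [0..<0]) 0" for e :: "nat \<Rightarrow> nat" by (rule computes.intros(1))
  then show ?case unfolding computable_def by blast
qed (rule computable_Suc)

lemma computable_subst1:
  assumes "computable (\<lambda>e. F (e 0) (\<lambda>i. e (Suc i)))" and "computable A"
  shows "computable (\<lambda>e. F (A e) e)"
  using computable_subst[OF assms(1), of "case_nat A (\<lambda>i e. e i)"] assms(2) computable_var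
  by (simp split: nat.split)

lemma computable_subst_fun2:
  assumes "computable (\<lambda>e. f (e 0) (e 1))" and "computable A" and "computable B"
  shows "computable (\<lambda>e. f (A e) (B e))"
  using computable_subst[OF assms(1), of "case_nat A (\<lambda>_. B)"] assms(2,3)
  by (simp split: nat.split)

lemma computable_subst_fun1:
  assumes "computable (\<lambda>e. f (e 0))" and "computable A"
  shows "computable (\<lambda>e. f (A e))"
  using computable_subst[OF assms(1), of "\<lambda>_. A"] assms(2) by simp

text \<open>
  Recursion and search are stated for the HOL operators \<open>rec_nat\<close> and \<open>LEAST\<close>, whose bound
  variables become the front of the environment in which the body is evaluated.
\<close>

lemma computable_rec_nat:
  assumes N: "computable N" and F: "computable F"
    and G: "computable (\<lambda>e. G (e 0) (e (Suc 0)) (\<lambda>i. e (Suc (Suc i))))"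
  shows "computable (\<lambda>e. rec_nat (F e) (\<lambda>k u. G k u e) (N e))"
proof -
  obtain n1 n2 where n1: "\<And>m. m \<ge> n1 \<Longrightarrow> \<exists>r. \<forall>e. computes r (map e [0..<m]) (F e)"
    and n2: "\<And>m. m \<ge> n2 \<Longrightarrow> \<exists>r. \<forall>e. computes r (map e [0..<m]) (G (e 0) (e (Suc 0)) (\<lambda>i. e (Suc (Suc i))))"
    using computable_arity[OF F] computable_arity[OF G] by blast
  define n where "n = max n1 n2"
  obtain f where f: "\<And>e. computes f (map e [0..<n]) (F e)"
    using n1[of n] by (auto simp: n_def)
  have "n2 \<le> Suc (Suc n)" by (simp add: n_def)
  then obtain g
    where g: "\<And>e. computes g (map e [0..<Suc (Suc n)]) (G (e 0) (e (Suc 0)) (\<lambda>i. e (Suc (Suc i))))"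
    using n2 by blast
  have rec: "computes (PrimRec f g) (k # map e [0..<n]) (rec_nat (F e) (\<lambda>k u. G k u e) k)" for k e
  proof (induction k)
    case 0
    then show ?case using f by (auto intro: computes.intros(5))
  next
    case (Suc k)
    let ?u = "rec_nat (F e) (\<lambda>k u. G k u e) k"
    have "computes g (k # ?u # map e [0..<n]) (G k ?u e)"
      using g[of "case_nat k (case_nat ?u e)"] by (simp only: map_case_nat_upt nat.case)
    with Suc show ?case by (auto intro: computes.intros(6))
  qed
  have "computes (PrimRec f g) (map e [0..<Suc n])
      (rec_nat (F (\<lambda>i. e (Suc i))) (\<lambda>k u. G k u (\<lambda>i. e (Suc i))) (e 0))" for e
  proof -
    have "e = case_nat (e 0) (\<lambda>i. e (Suc i))" by (auto simp: fun_eq_iff split: nat.split)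
    then have "map e [0..<Suc n] = e 0 # map (\<lambda>i. e (Suc i)) [0..<n]"
      by (metis map_case_nat_upt)
    with rec show ?thesis by simp
  qed
  then have "computable (\<lambda>e. rec_nat (F (\<lambda>i. e (Suc i))) (\<lambda>k u. G k u (\<lambda>i. e (Suc i))) (e 0))"
    unfolding computable_def by blast
  from computable_subst1[OF this N] show ?thesis .
qed

lemma computable_Least_zero:
  assumes G: "computable (\<lambda>e. G (e 0) (\<lambda>i. e (Suc i)))" and total: "\<And>e. \<exists>y. G y e = 0"
  shows "computable (\<lambda>e. LEAST y. G y e = (0::nat))"
proof -
  obtain n where "\<And>m. m \<ge> n \<Longrightarrow> \<exists>r. \<forall>e. computes r (map e [0..<m]) (G (e 0) (\<lambda>i. e (Suc i)))"
    using computable_arity[OF G] by blast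
  from this[of "Suc n"] obtain g
    where g: "\<And>e. computes g (map e [0..<Suc n]) (G (e 0) (\<lambda>i. e (Suc i)))" by auto
  have g': "computes g (y # map e [0..<n]) (G y e)" for y e
    using g[of "case_nat y e"] by (simp only: map_case_nat_upt nat.case)
  have "computes (Mu g) (map e [0..<n]) (LEAST y. G y e = 0)" for e
  proof (rule computes.intros(7))
    have "G (LEAST y. G y e = 0) e = 0" using total[of e] by (rule LeastI_ex)
    then show "computes g ((LEAST y. G y e = 0) # map e [0..<n]) 0"
      using g'[of "LEAST y. G y e = 0" e] by simp
    show "\<forall>m<LEAST y. G y e = 0. \<exists>k. computes g (m # map e [0..<n]) (Suc k)"
    proof (intro allI impI)
      fix m assume "m < (LEAST y. G y e = 0)"
      then have "G m e \<noteq> 0" by (rule not_less_Least)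
      then obtain k where "G m e = Suc k" using not0_implies_Suc by blast
      with g'[of m e] show "\<exists>k. computes g (m # map e [0..<n]) (Suc k)" by auto
    qed
  qed
  then show ?thesis unfolding computable_def by blast
qed

subsection \<open>Arithmetic\<close>

lemma computable_add:
  assumes "computable A" "computable B" shows "computable (\<lambda>e. A e + B e)"
proof -
  have eq: "m + n = rec_nat m (\<lambda>k u. Suc u) n" for m n :: nat by (induction n) simp_all
  show ?thesis unfolding eq by (intro computable_rec_nat computable_Suc computable_var assms)
qed

lemma computable_mult:
  assumes "computable A" "computable B" shows "computable (\<lambda>e. A e * B e)"
proof -
  have "m * n = rec_nat 0 (\<lambda>k u. u + m) n" for m n :: nat by (induction n) simp_all
  moreover have "computable (\<lambda>e. rec_nat 0 (\<lambda>k u. u + e 0) (e 1))"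
    by (intro computable_rec_nat computable_add computable_var computable_const)
  ultimately have "computable (\<lambda>e. e 0 * e 1)" by simp
  from computable_subst_fun2[of "(*)", OF this assms] show ?thesis .
qed

lemma computable_diff:
  assumes "computable A" "computable B" shows "computable (\<lambda>e. A e - B e)"
proof -
  have "n - 1 = rec_nat 0 (\<lambda>k u. k) n" for n :: nat by (induction n) simp_all
  moreover have "computable (\<lambda>e. rec_nat 0 (\<lambda>k u. k) (e 0))"
    by (intro computable_rec_nat computable_var computable_const)
  ultimately have "computable (\<lambda>e. e 0 - 1)" by simp
  note pred = computable_subst_fun1[of "\<lambda>x. x - 1", OF this]
  have "m - n = rec_nat m (\<lambda>k u. u - 1) n" for m n :: nat by (induction n) simp_all
  then have "(\<lambda>e :: nat \<Rightarrow> nat. e 0 - e 1) = (\<lambda>e. rec_nat (e 0) (\<lambda>k u. u - 1) (e 1))" by blast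
  moreover have "computable (\<lambda>e. rec_nat (e 0) (\<lambda>k u. u - 1) (e 1))"
    by (intro computable_rec_nat pred computable_var)
  ultimately have "computable (\<lambda>e. e 0 - e 1)" by (simp only:)
  from computable_subst_fun2[of "(-)", OF this assms] show ?thesis .
qed

lemma computable_prod_encode:
  assumes "computable A" "computable B" shows "computable (\<lambda>e. prod_encode (A e, B e))"
proof -
  have t: "triangle n = rec_nat 0 (\<lambda>k u. u + Suc k) n" for n by (induction n) simp_all
  show ?thesis unfolding prod_encode_def split_conv t
    by (intro computable_add computable_rec_nat computable_Suc computable_var computable_const assms)
qed

section \<open>Decidable predicates\<close>

definition decidable :: "((nat \<Rightarrow> nat) \<Rightarrow> bool) \<Rightarrow> bool" where
  "decidable P \<longleftrightarrow> computable (\<lambda>e. of_bool (P e))"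

lemma decidable_subst:
  assumes "decidable P" and "\<And>i. computable (A i)"
  shows "decidable (\<lambda>e. P (\<lambda>i. A i e))"
  using computable_subst[OF assms[unfolded decidable_def]] unfolding decidable_def .

lemma decidable_subst_Suc:
  assumes "decidable (\<lambda>e. Q (e 0) (\<lambda>i. e (Suc i)))" "computable B" "\<And>i. computable (A i)"
  shows "decidable (\<lambda>e. Q (B e) (\<lambda>i. A i e))"
  using decidable_subst[OF assms(1), of "case_nat B A"] assms(2,3) by (simp split: nat.split)

lemma decidable_subst_case_nat:
  assumes "decidable (\<lambda>e. Q (e 0) (\<lambda>i. e (Suc i)))" "computable B" "computable Y"
    "\<And>i. computable (A i)"
  shows "decidable (\<lambda>e. Q (B e) (case_nat (Y e) (\<lambda>i. A i e)))"
proof -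
  have "decidable (\<lambda>e. Q (B e) (\<lambda>i. case_nat Y A i e))"
    by (rule decidable_subst_Suc[OF assms(1,2)]) (use assms(3,4) in \<open>simp split: nat.split\<close>)
  moreover have "(\<lambda>i. case_nat Y A i e) = case_nat (Y e) (\<lambda>i. A i e)" for e
    by (auto simp: fun_eq_iff split: nat.split)
  ultimately show ?thesis by simp
qed

lemma decidable_not:
  assumes "decidable P" shows "decidable (\<lambda>e. \<not> P e)"
proof -
  have "of_bool (\<not> b) = 1 - (of_bool b :: nat)" for b by simp
  then show ?thesis using assms unfolding decidable_def
    by (simp only:) (intro computable_diff computable_const)
qed

lemma decidable_conj:
  assumes "decidable P" "decidable Q" shows "decidable (\<lambda>e. P e \<and> Q e)"
  using assms unfolding decidable_def of_bool_conj by (rule computable_mult)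

lemma decidable_disj:
  assumes "decidable P" "decidable Q" shows "decidable (\<lambda>e. P e \<or> Q e)"
  using decidable_not[OF decidable_conj[OF assms[THEN decidable_not]]] by simp

lemma decidable_imp:
  assumes "decidable P" "decidable Q" shows "decidable (\<lambda>e. P e \<longrightarrow> Q e)"
  unfolding imp_conv_disj by (intro decidable_disj decidable_not assms)

lemma decidable_le:
  assumes "computable A" "computable B" shows "decidable (\<lambda>e. A e \<le> B e)"
proof -
  have "of_bool (a \<le> b) = 1 - (a - b)" for a b :: nat by auto
  then show ?thesis using assms unfolding decidable_def
    by (simp only:) (intro computable_diff computable_const)
qed

lemma decidable_less:
  assumes "computable A" "computable B" shows "decidable (\<lambda>e. A e < B e)"
  unfolding Suc_le_eq[symmetric] by (intro decidable_le computable_Suc assms)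

lemma decidable_eq:
  assumes "computable A" "computable B" shows "decidable (\<lambda>e. A e = B e)"
  unfolding order_eq_iff by (intro decidable_conj decidable_le assms)

lemma decidable_Ex_less:
  assumes P: "decidable (\<lambda>e. P (e 0) (\<lambda>i. e (Suc i)))" and N: "computable N"
  shows "decidable (\<lambda>e. \<exists>i<N e. P i e)"
proof -
  have eq: "(\<exists>i<n. P i e) \<longleftrightarrow> (0::nat) < rec_nat 0 (\<lambda>k u. u + of_bool (P k e)) n" for n e
    by (induction n) (auto simp: less_Suc_eq)
  have "decidable (\<lambda>e. P (e 0) (\<lambda>i. e (Suc (Suc i))))"
    by (intro decidable_subst_Suc[OF P] computable_var)
  then show ?thesis unfolding eq
    by (intro decidable_less computable_rec_nat computable_add N computable_const computable_var)
      (simp add: decidable_def)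
qed

lemma decidable_All_less:
  assumes P: "decidable (\<lambda>e. P (e 0) (\<lambda>i. e (Suc i)))" and N: "computable N"
  shows "decidable (\<lambda>e. \<forall>i<N e. P i e)"
  using decidable_not[OF decidable_Ex_less[where P = "\<lambda>i e. \<not> P i e", OF decidable_not[OF P] N]]
  by simp

lemma computable_Least:
  assumes P: "decidable (\<lambda>e. P (e 0) (\<lambda>i. e (Suc i)))" and total: "\<And>e. \<exists>y. P y e"
  shows "computable (\<lambda>e. LEAST y. P y e)"
proof -
  have "computable (\<lambda>e. LEAST y. of_bool (\<not> P y e) = (0::nat))"
    using decidable_not[OF P] total unfolding decidable_def by (intro computable_Least_zero) auto
  then show ?thesis by simp
qed

section \<open>Semidecidable predicates\<close>

definition semidecidable :: "((nat \<Rightarrow> nat) \<Rightarrow> bool) \<Rightarrow> bool" where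
  "semidecidable P \<longleftrightarrow>
     (\<exists>Q. decidable (\<lambda>e. Q (e 0) (\<lambda>i. e (Suc i))) \<and> (\<forall>e. P e \<longleftrightarrow> (\<exists>b. Q b e)))"

text \<open>
  A witness may be replaced by a bound on witnesses. A bound can be increased, so that several
  semidecidable conditions can share one, and this makes the closure properties below independent
  of any coding of pairs or sequences.
\<close>

lemma semidecidableE:
  assumes "semidecidable P"
  obtains Q where "decidable (\<lambda>e. Q (e 0) (\<lambda>i. e (Suc i)))" "\<And>e. P e \<longleftrightarrow> (\<exists>b. Q b e)"
    "\<And>b c e. Q b e \<Longrightarrow> b \<le> c \<Longrightarrow> Q c e"
proof -
  obtain Q where Q: "decidable (\<lambda>e. Q (e 0) (\<lambda>i. e (Suc i)))" "\<And>e. P e \<longleftrightarrow> (\<exists>b. Q b e)"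
    using assms unfolding semidecidable_def by blast
  have "decidable (\<lambda>e. Q (e 0) (\<lambda>i. e (Suc (Suc i))))"
    by (intro decidable_subst_Suc[OF Q(1)] computable_var)
  then have "decidable (\<lambda>e. \<exists>c<e 0. Q c (\<lambda>i. e (Suc i)))"
    by (intro decidable_Ex_less computable_var)
  moreover have "P e \<longleftrightarrow> (\<exists>b. \<exists>c<b. Q c e)" for e
    using Q(2) by (metis lessI)
  ultimately show thesis using that[of "\<lambda>b e. \<exists>c<b. Q c e"] using order_less_le_trans by blast
qed

lemma semidecidable_decidable:
  assumes "decidable P" shows "semidecidable P"
proof -
  have "decidable (\<lambda>e. P (\<lambda>i. e (Suc i)))" by (intro decidable_subst[OF assms] computable_var)
  then show ?thesis unfolding semidecidable_def by (intro exI[of _ "\<lambda>_. P"]) auto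
qed

lemma semidecidable_conj:
  assumes "semidecidable P" "semidecidable P'" shows "semidecidable (\<lambda>e. P e \<and> P' e)"
proof -
  obtain Q where Q: "decidable (\<lambda>e. Q (e 0) (\<lambda>i. e (Suc i)))" "\<And>e. P e \<longleftrightarrow> (\<exists>b. Q b e)"
    "\<And>b c e. Q b e \<Longrightarrow> b \<le> c \<Longrightarrow> Q c e"
    using assms(1) by (rule semidecidableE) blast
  obtain Q' where Q': "decidable (\<lambda>e. Q' (e 0) (\<lambda>i. e (Suc i)))" "\<And>e. P' e \<longleftrightarrow> (\<exists>b. Q' b e)"
    "\<And>b c e. Q' b e \<Longrightarrow> b \<le> c \<Longrightarrow> Q' c e"
    using assms(2) by (rule semidecidableE) blast
  have "P e \<and> P' e \<longleftrightarrow> (\<exists>b. Q b e \<and> Q' b e)" for e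
    unfolding Q(2) Q'(2) using Q(3) Q'(3) by (meson max.cobounded1 max.cobounded2)
  then show ?thesis unfolding semidecidable_def
    by (intro exI[of _ "\<lambda>b e. Q b e \<and> Q' b e"]) (auto intro: decidable_conj Q(1) Q'(1))
qed

lemma semidecidable_disj:
  assumes "semidecidable P" "semidecidable P'" shows "semidecidable (\<lambda>e. P e \<or> P' e)"
proof -
  obtain Q where Q: "decidable (\<lambda>e. Q (e 0) (\<lambda>i. e (Suc i)))" "\<And>e. P e \<longleftrightarrow> (\<exists>b. Q b e)"
    using assms(1) by (rule semidecidableE) blast
  obtain Q' where Q': "decidable (\<lambda>e. Q' (e 0) (\<lambda>i. e (Suc i)))" "\<And>e. P' e \<longleftrightarrow> (\<exists>b. Q' b e)"
    using assms(2) by (rule semidecidableE) blast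
  from Q Q' show ?thesis unfolding semidecidable_def
    by (intro exI[of _ "\<lambda>b e. Q b e \<or> Q' b e"]) (auto intro: decidable_disj Q(1) Q'(1))
qed

lemma semidecidable_Ex:
  assumes "semidecidable (\<lambda>e. P (e 0) (\<lambda>i. e (Suc i)))" shows "semidecidable (\<lambda>e. \<exists>y. P y e)"
proof -
  obtain Q where Q: "decidable (\<lambda>e. Q (e 0) (\<lambda>i. e (Suc i)))"
    "\<And>e. P (e 0) (\<lambda>i. e (Suc i)) \<longleftrightarrow> (\<exists>b. Q b e)"
    "\<And>b c e. Q b e \<Longrightarrow> b \<le> c \<Longrightarrow> Q c e"
    using assms by (rule semidecidableE) blast
  have P: "P y e \<longleftrightarrow> (\<exists>b. Q b (case_nat y e))" for y e
    using Q(2)[of "case_nat y e"] by simp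
  have "decidable (\<lambda>e. Q (e (Suc 0)) (case_nat (e 0) (\<lambda>i. e (Suc (Suc i)))))"
    by (intro decidable_subst_case_nat[OF Q(1)] computable_var)
  then have "decidable (\<lambda>e. \<exists>y<e 0. Q (e 0) (case_nat y (\<lambda>i. e (Suc i))))"
    by (intro decidable_Ex_less computable_var)
  moreover have "(\<exists>y. P y e) \<longleftrightarrow> (\<exists>b. \<exists>y<b. Q b (case_nat y e))" for e
  proof
    assume "\<exists>y. P y e"
    then obtain y b where "Q b (case_nat y e)" unfolding P by blast
    then have "Q (Suc (y + b)) (case_nat y e)" by (rule Q(3)) simp
    then show "\<exists>b. \<exists>y<b. Q b (case_nat y e)" by (meson le_add1 le_imp_less_Suc)
  qed (auto simp: P)
  ultimately show ?thesis unfolding semidecidable_def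
    by (intro exI[of _ "\<lambda>b e. \<exists>y<b. Q b (case_nat y e)"]) auto
qed

lemma semidecidable_subst:
  assumes "semidecidable P" and A: "\<And>i. computable (A i)"
  shows "semidecidable (\<lambda>e. P (\<lambda>i. A i e))"
proof -
  obtain Q where Q: "decidable (\<lambda>e. Q (e 0) (\<lambda>i. e (Suc i)))" "\<And>e. P e \<longleftrightarrow> (\<exists>b. Q b e)"
    using assms(1) by (rule semidecidableE) blast
  have "computable (\<lambda>e. A i (\<lambda>i. e (Suc i)))" for i by (intro computable_subst[OF A] computable_var)
  then have "decidable (\<lambda>e. Q (e 0) (\<lambda>i. A i (\<lambda>i. e (Suc i))))"
    by (intro decidable_subst_Suc[OF Q(1)] computable_var)
  then show ?thesis unfolding semidecidable_def
    by (intro exI[of _ "\<lambda>b e. Q b (\<lambda>i. A i e)"]) (auto simp: Q(2))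
qed

lemma semidecidable_All_less:
  assumes P: "semidecidable (\<lambda>e. P (e 0) (\<lambda>i. e (Suc i)))" and N: "computable N"
  shows "semidecidable (\<lambda>e. \<forall>i<N e. P i e)"
proof -
  obtain Q where Q: "decidable (\<lambda>e. Q (e 0) (\<lambda>i. e (Suc i)))"
    "\<And>e. P (e 0) (\<lambda>i. e (Suc i)) \<longleftrightarrow> (\<exists>b. Q b e)"
    "\<And>b c e. Q b e \<Longrightarrow> b \<le> c \<Longrightarrow> Q c e"
    using P by (rule semidecidableE) blast
  have P': "P y e \<longleftrightarrow> (\<exists>b. Q b (case_nat y e))" for y e
    using Q(2)[of "case_nat y e"] by simp
  have "decidable (\<lambda>e. Q (e (Suc 0)) (case_nat (e 0) (\<lambda>i. e (Suc (Suc i)))))"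
    by (intro decidable_subst_case_nat[OF Q(1)] computable_var)
  moreover have "computable (\<lambda>e. N (\<lambda>i. e (Suc i)))" by (intro computable_subst[OF N] computable_var)
  ultimately have "decidable (\<lambda>e. \<forall>i<N (\<lambda>i. e (Suc i)). Q (e 0) (case_nat i (\<lambda>i. e (Suc i))))"
    by (intro decidable_All_less)
  moreover have "(\<forall>i<N e. P i e) \<longleftrightarrow> (\<exists>b. \<forall>i<N e. Q b (case_nat i e))" for e
  proof
    assume "\<forall>i<N e. P i e"
    then obtain b where b: "\<And>i. i < N e \<Longrightarrow> Q (b i) (case_nat i e)" unfolding P' by metis
    have "Q (\<Sum>i<N e. b i) (case_nat i e)" if "i < N e" for i
    proof (rule Q(3))
      show "Q (b i) (case_nat i e)" using b that .
      show "b i \<le> (\<Sum>i<N e. b i)" using that by (intro member_le_sum) auto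
    qed
    then show "\<exists>b. \<forall>i<N e. Q b (case_nat i e)" by blast
  qed (auto simp: P')
  ultimately show ?thesis unfolding semidecidable_def
    by (intro exI[of _ "\<lambda>b e. \<forall>i<N e. Q b (case_nat i e)"]) auto
qed

text \<open>
  Searching for a value together with a witness computes a total function from a semidecision
  procedure for its graph. Hence the inverses of coding functions need no algorithms of their own.
\<close>

lemma computable_graph:
  assumes "semidecidable (\<lambda>e. F (\<lambda>i. e (Suc i)) = e 0)"
  shows "computable F"
proof -
  obtain Q where Q: "decidable (\<lambda>e. Q (e 0) (\<lambda>i. e (Suc i)))"
    "\<And>e. F (\<lambda>i. e (Suc i)) = e 0 \<longleftrightarrow> (\<exists>b. Q b e)"
    "\<And>b c e. Q b e \<Longrightarrow> b \<le> c \<Longrightarrow> Q c e"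
    using assms by (rule semidecidableE) blast
  have F: "F e = y \<longleftrightarrow> (\<exists>b. Q b (case_nat y e))" for y e
    using Q(2)[of "case_nat y e"] by simp
  have dec: "decidable (\<lambda>e. Q (e i) (case_nat (e j) (\<lambda>i. e (k i))))" for i j k
    by (intro decidable_subst_case_nat[OF Q(1)] computable_var)
  define B where "B e = (LEAST b. \<exists>y<b. Q b (case_nat y e))" for e
  have ex: "\<exists>b. \<exists>y<b. Q b (case_nat y e)" for e
  proof -
    obtain b where "Q b (case_nat (F e) e)" using F by blast
    then have "Q (Suc (F e + b)) (case_nat (F e) e)" by (rule Q(3)) simp
    then show ?thesis by (meson le_add1 le_imp_less_Suc)
  qed
  have "computable B" unfolding B_def
    by (intro computable_Least decidable_Ex_less dec computable_var ex)
  have "decidable (\<lambda>e. Q (B (\<lambda>i. e (Suc i))) (case_nat (e 0) (\<lambda>i. e (Suc i))))"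
    by (intro decidable_subst_case_nat[OF Q(1)] computable_subst[OF \<open>computable B\<close>] computable_var)
  moreover have B: "\<exists>y. Q (B e) (case_nat y e)" for e
    using LeastI_ex[OF ex[of e]] unfolding B_def by blast
  ultimately have "computable (\<lambda>e. LEAST y. Q (B e) (case_nat y e))"
    by (intro computable_Least)
  moreover have "F = (\<lambda>e. LEAST y. Q (B e) (case_nat y e))"
  proof
    fix e
    have "Q (B e) (case_nat (LEAST y. Q (B e) (case_nat y e)) e)" by (rule LeastI_ex[OF B])
    then show "F e = (LEAST y. Q (B e) (case_nat y e))" unfolding F by blast
  qed
  ultimately show ?thesis by (rule ssubst[of F, rotated])
qed

lemma semidecidable_eq:
  assumes "computable A" "computable B" shows "semidecidable (\<lambda>e. A e = B e)"
  using assms by (intro semidecidable_decidable decidable_eq)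

lemma semidecidable_less:
  assumes "computable A" "computable B" shows "semidecidable (\<lambda>e. A e < B e)"
  using assms by (intro semidecidable_decidable decidable_less)

lemma semidecidable_le:
  assumes "computable A" "computable B" shows "semidecidable (\<lambda>e. A e \<le> B e)"
  using assms by (intro semidecidable_decidable decidable_le)

lemmas computable_intros = computable_const computable_var computable_Suc computable_add
  computable_mult computable_diff computable_prod_encode

lemmas decidable_intros = decidable_conj decidable_disj decidable_not decidable_All_less
  decidable_Ex_less decidable_imp decidable_eq decidable_less decidable_le

lemmas semidecidable_intros = semidecidable_conj semidecidable_disj semidecidable_All_less
  semidecidable_Ex semidecidable_eq semidecidable_less semidecidable_le

lemma computable_fst_prod_decode:
  assumes "computable A" shows "computable (\<lambda>e. fst (prod_decode (A e)))"
proof -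
  have "fst (prod_decode z) = x \<longleftrightarrow> (\<exists>y. z = prod_encode (x, y))" for z x
    by (metis fst_conv prod.collapse prod_decode_inverse prod_encode_inverse)
  moreover have "semidecidable (\<lambda>e. \<exists>y. e 1 = prod_encode (e 0, y))"
    by (intro semidecidable_intros computable_intros)
  ultimately have "computable (\<lambda>e. fst (prod_decode (e 0)))"
    by (intro computable_graph) simp
  from computable_subst_fun1[OF this assms] show ?thesis .
qed

lemma computable_snd_prod_decode:
  assumes "computable A" shows "computable (\<lambda>e. snd (prod_decode (A e)))"
proof -
  have "snd (prod_decode z) = y \<longleftrightarrow> (\<exists>x. z = prod_encode (x, y))" for z y
    by (metis snd_conv prod.collapse prod_decode_inverse prod_encode_inverse)
  moreover have "semidecidable (\<lambda>e. \<exists>x. e 1 = prod_encode (x, e 0))"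
    by (intro semidecidable_intros computable_intros)
  ultimately have "computable (\<lambda>e. snd (prod_decode (e 0)))"
    by (intro computable_graph) simp
  from computable_subst_fun1[OF this assms] show ?thesis .
qed

section \<open>Lists coded by numbers\<close>

definition code_Cons :: "nat \<Rightarrow> nat \<Rightarrow> nat" where
  "code_Cons x a = Suc (prod_encode (x, a))"

definition code_drop :: "nat \<Rightarrow> nat \<Rightarrow> nat" where
  "code_drop n a = rec_nat a (\<lambda>_ u. snd (prod_decode (u - 1))) n"

definition code_nth :: "nat \<Rightarrow> nat \<Rightarrow> nat" where
  "code_nth a i = fst (prod_decode (code_drop i a - 1))"

definition code_length :: "nat \<Rightarrow> nat" where
  "code_length a = (LEAST n. code_drop n a = 0)"

lemma code_Cons_eq: "code_Cons x (list_encode xs) = list_encode (x # xs)"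
  by (simp add: code_Cons_def)

text \<open>
  The default \<open>0\<close> codes the empty list and decodes to the pair \<open>(0, 0)\<close>, so that
  dropping too many elements ends in the empty list, exactly as it does for \<open>drop\<close>.
\<close>

lemma code_drop_eq: "code_drop n (list_encode xs) = list_encode (drop n xs)"
proof (induction n)
  case (Suc n)
  have "prod_decode 0 = (0, 0)"
    by (simp add: prod_decode_def prod_decode_aux.simps)
  then have "snd (prod_decode (list_encode ys - 1)) = list_encode (tl ys)" for ys
    by (cases ys) simp_all
  with Suc show ?case by (simp add: code_drop_def drop_Suc tl_drop)
qed (simp add: code_drop_def)

lemma list_encode_eq_0_iff: "list_encode xs = 0 \<longleftrightarrow> xs = []"
  by (cases xs) simp_all

lemma code_length_eq: "code_length (list_encode xs) = length xs"
  unfolding code_length_def code_drop_eq list_encode_eq_0_iff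
  by (rule Least_equality) simp_all

lemma code_nth_eq: "i < length xs \<Longrightarrow> code_nth (list_encode xs) i = xs ! i"
  by (simp add: code_nth_def code_drop_eq flip: Cons_nth_drop_Suc)

lemma computable_code_Cons:
  assumes "computable A" "computable B" shows "computable (\<lambda>e. code_Cons (A e) (B e))"
  unfolding code_Cons_def by (intro computable_intros assms)

lemma computable_code_drop:
  assumes "computable A" "computable B" shows "computable (\<lambda>e. code_drop (A e) (B e))"
  unfolding code_drop_def
  by (intro computable_rec_nat computable_snd_prod_decode computable_intros assms)

lemma computable_code_nth:
  assumes "computable A" "computable B" shows "computable (\<lambda>e. code_nth (A e) (B e))"
  unfolding code_nth_def
  by (intro computable_fst_prod_decode computable_code_drop computable_intros assms)

lemma computable_code_length:
  assumes "computable A" shows "computable (\<lambda>e. code_length (A e))"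
proof -
  have "\<exists>n. code_drop n a = 0" for a
    using code_drop_eq[of "length (list_decode a)" "list_decode a"] by (auto simp: list_decode_inverse)
  then have "computable (\<lambda>e. code_length (e 0))" unfolding code_length_def
    by (intro computable_Least decidable_eq computable_code_drop computable_intros)
  from computable_subst_fun1[OF this assms] show ?thesis .
qed

lemmas computable_list_intros = computable_intros computable_code_Cons computable_code_drop
  computable_code_nth computable_code_length

section \<open>Recursive and recursively enumerable sets\<close>

lemma total_recursive_computable: "total_recursive f \<longleftrightarrow> computable (\<lambda>e. f (e 0))"
proof
  assume "total_recursive f"
  then obtain r where "\<And>x. computes r [x] (f x)" unfolding total_recursive_def by blast
  then have "\<And>e. computes r (map e [0..<1]) (f (e 0))" by simp
  then show "computable (\<lambda>e. f (e 0))" unfolding computable_def by blast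
next
  assume "computable (\<lambda>e. f (e 0))"
  then obtain n r where r: "\<And>e. computes r (map e [0..<n]) (f (e 0))"
    unfolding computable_def by blast
  have "computes (Comp r (map (\<lambda>_. Proj 0) [0..<n])) [x] (f x)" for x
    by (rule computes_Comp_map[where a = "\<lambda>_. x"])
      (use r[of "\<lambda>_. x"] computes.intros(3)[of 0 "[x]"] in auto)
  then show "total_recursive f" unfolding total_recursive_def by blast
qed

lemma recursive_set_decidable: "recursive_set A \<longleftrightarrow> decidable (\<lambda>e. e 0 \<in> A)"
  using total_recursive_computable[of "\<lambda>x. of_bool (x \<in> A)"]
  unfolding recursive_set_def total_recursive_def decidable_def of_bool_def .

lemma recursive_relation_decidable: "recursive_relation R \<longleftrightarrow> decidable (\<lambda>e. R (e 0) (e 1))"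
proof
  assume "recursive_relation R"
  then obtain r where "\<And>x y. computes r [x, y] (of_bool (R x y))"
    unfolding recursive_relation_def of_bool_def by blast
  then have "\<And>e. computes r (map e [0..<2]) (of_bool (R (e 0) (e 1)))" by (simp add: upt_rec)
  then show "decidable (\<lambda>e. R (e 0) (e 1))" unfolding decidable_def computable_def by blast
next
  assume "decidable (\<lambda>e. R (e 0) (e 1))"
  then obtain n r where r: "\<And>e. computes r (map e [0..<n]) (of_bool (R (e 0) (e 1)))"
    unfolding decidable_def computable_def by blast
  have "computes (Comp r (map (\<lambda>i. Proj (min i 1)) [0..<n])) [x, y] (of_bool (R x y))" for x y
  proof (rule computes_Comp_map)
    show "computes (Proj (min i 1)) [x, y] (case_nat x (\<lambda>_. y) i)" for i
      using computes.intros(3)[of "min i 1" "[x, y]"] by (cases i) simp_all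
    show "computes r (map (case_nat x (\<lambda>_. y)) [0..<n]) (of_bool (R x y))"
      using r[of "case_nat x (\<lambda>_. y)"] by simp
  qed
  then show "recursive_relation R" unfolding recursive_relation_def of_bool_def by blast
qed

lemma decidable_subst_fun2:
  assumes "decidable (\<lambda>e. R (e 0) (e 1))" "computable A" "computable B"
  shows "decidable (\<lambda>e. R (A e) (B e))"
  using computable_subst_fun2[of "\<lambda>x y. of_bool (R x y)"] assms unfolding decidable_def by blast

lemma sigma01_semidecidable: "sigma01 A \<longleftrightarrow> semidecidable (\<lambda>e. e 0 \<in> A)"
proof
  assume "sigma01 A"
  then obtain R where R: "decidable (\<lambda>e. R (e 0) (e 1))" and A: "A = {x. \<exists>y. R x y}"
    unfolding sigma01_def recursive_relation_decidable by blast
  have "semidecidable (\<lambda>e. \<exists>y. R (e 0) y)"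
    by (intro semidecidable_Ex semidecidable_decidable decidable_subst_fun2[OF R] computable_var)
  then show "semidecidable (\<lambda>e. e 0 \<in> A)" by (simp add: A)
next
  assume "semidecidable (\<lambda>e. e 0 \<in> A)"
  then obtain Q where Q: "decidable (\<lambda>e. Q (e 0) (\<lambda>i. e (Suc i)))" "\<And>e. e 0 \<in> A \<longleftrightarrow> (\<exists>b. Q b e)"
    unfolding semidecidable_def by blast
  have "decidable (\<lambda>e. Q (e 1) (\<lambda>i. e 0))"
    by (intro decidable_subst_Suc[OF Q(1)] computable_var)
  moreover have "A = {x. \<exists>y. Q y (\<lambda>_. x)}"
    using Q(2)[of "\<lambda>_. _"] by auto
  ultimately show "sigma01 A" unfolding sigma01_def recursive_relation_decidable
    by (intro exI[of _ "\<lambda>x y. Q y (\<lambda>_. x)"]) simp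
qed

lemma many_one_reducible_trans:
  assumes "many_one_reducible A B" "many_one_reducible B C" shows "many_one_reducible A C"
proof -
  obtain f g where "total_recursive f" and f: "\<And>x. x \<in> A \<longleftrightarrow> f x \<in> B"
    and "total_recursive g" and g: "\<And>x. x \<in> B \<longleftrightarrow> g x \<in> C"
    using assms unfolding many_one_reducible_def by blast
  then have "total_recursive (\<lambda>x. g (f x))"
    using computable_subst_fun1[of g "\<lambda>e. f (e 0)"] by (simp add: total_recursive_computable)
  with f g show ?thesis unfolding many_one_reducible_def by blast
qed

section \<open>A complete recursively enumerable set\<close>

fun program_code :: "recf \<Rightarrow> nat" where
  "program_code Zero = prod_encode (0, 0)"
| "program_code Succ = prod_encode (1, 0)"
| "program_code (Proj i) = prod_encode (2, i)"
| "program_code (Comp f gs) =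
     prod_encode (3, prod_encode (program_code f, list_encode (map program_code gs)))"
| "program_code (PrimRec f g) = prod_encode (4, prod_encode (program_code f, program_code g))"
| "program_code (Mu f) = prod_encode (5, program_code f)"

definition judgement :: "nat \<Rightarrow> nat \<Rightarrow> nat \<Rightarrow> nat" where
  "judgement p a v = prod_encode (p, prod_encode (a, v))"

text \<open>
  One inference step of the inductive definition of \<open>computes\<close>, on codes. The premises are not
  recursive occurrences of the predicate but range over a parameter \<open>T\<close>, so that a step can be
  checked locally: for derivations \<open>T\<close> is membership in a list, for soundness it is truth.
\<close>

inductive justified :: "(nat \<Rightarrow> bool) \<Rightarrow> nat \<Rightarrow> bool" for T where
  Zero: "justified T (judgement (prod_encode (0, 0)) a 0)"
| Succ: "justified T (judgement (prod_encode (1, 0)) (code_Cons x a) (Suc x))"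
| Proj: "i < code_length a \<Longrightarrow> justified T (judgement (prod_encode (2, i)) a (code_nth a i))"
| Comp: "code_length gs = code_length ys \<Longrightarrow>
    \<forall>i<code_length gs. T (judgement (code_nth gs i) a (code_nth ys i)) \<Longrightarrow>
    T (judgement f ys v) \<Longrightarrow>
    justified T (judgement (prod_encode (3, prod_encode (f, gs))) a v)"
| PrimRec_0: "T (judgement f a v) \<Longrightarrow>
    justified T (judgement (prod_encode (4, prod_encode (f, g))) (code_Cons 0 a) v)"
| PrimRec_Suc: "T (judgement (prod_encode (4, prod_encode (f, g))) (code_Cons n a) u) \<Longrightarrow>
    T (judgement g (code_Cons n (code_Cons u a)) v) \<Longrightarrow>
    justified T (judgement (prod_encode (4, prod_encode (f, g))) (code_Cons (Suc n) a) v)"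
| Mu: "T (judgement f (code_Cons n a) 0) \<Longrightarrow>
    \<forall>m<n. \<exists>k. T (judgement f (code_Cons m a) (Suc k)) \<Longrightarrow>
    justified T (judgement (prod_encode (5, f)) a n)"

text \<open>
  Codes of nonempty lists are kept in the form in which the rules mention them.
\<close>

declare list_encode.simps(2) [simp del] code_Cons_eq [symmetric, simp]

lemma judgement_eq_iff [simp]:
  "judgement p a v = judgement p' a' v' \<longleftrightarrow> p = p' \<and> a = a' \<and> v = v'"
  by (simp add: judgement_def)

lemma list_encode_eq_code_Cons:
  "list_encode xs = code_Cons x a \<longleftrightarrow> (\<exists>ys. a = list_encode ys \<and> xs = x # ys)"
proof
  assume "list_encode xs = code_Cons x a"
  then have "list_encode xs = list_encode (x # list_decode a)" by simp
  then show "\<exists>ys. a = list_encode ys \<and> xs = x # ys"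
    by (metis list_decode_inverse list_encode_eq)
qed auto

lemma justified_mono:
  assumes "justified T j" and "\<And>i. T i \<Longrightarrow> T' i" shows "justified T' j"
  using assms(1)
proof cases
  case Succ
  then show ?thesis by (simp only: justified.Succ)
next
  case Comp
  with assms(2) show ?thesis by (simp only:) (rule justified.Comp, auto)
next
  case Mu
  with assms(2) show ?thesis by (simp only:) (rule justified.Mu, auto, blast)
qed (auto intro: justified.intros assms(2))

text \<open>
  A number may code a judgement about a number that is no program code at all; nothing is
  demanded of those.
\<close>

definition true_judgement :: "nat \<Rightarrow> bool" where
  "true_judgement j \<longleftrightarrow>
     (\<forall>f xs v. j = judgement (program_code f) (list_encode xs) v \<longrightarrow> computes f xs v)"

lemma justified_sound:
  assumes "justified true_judgement j" shows "true_judgement j"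
  unfolding true_judgement_def
proof (intro allI impI)
  fix F xs v assume j: "j = judgement (program_code F) (list_encode xs) v"
  have T: "computes f ys w" if "true_judgement (judgement (program_code f) (list_encode ys) w)" for f ys w
    using that unfolding true_judgement_def by blast
  from assms[unfolded j] show "computes F xs v"
  proof cases
    case (Zero a)
    then show ?thesis by (cases F) (auto intro: computes.intros(1))
  next
    case (Succ x a)
    then show ?thesis
      by (cases F) (auto simp: list_encode_eq_code_Cons intro: computes.intros(2))
  next
    case (Proj i a)
    then show ?thesis
      by (cases F) (auto simp: code_length_eq code_nth_eq intro: computes.intros(3))
  next
    case (Comp gs ys a f w)
    then obtain f' gs' where F: "F = Comp f' gs'"
      and f: "f = program_code f'" and gs: "gs = list_encode (map program_code gs')"
      by (cases F) auto
    obtain zs where ys: "ys = list_encode zs" by (metis list_decode_inverse)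
    have "list_all2 (\<lambda>g y. computes g xs y) gs' zs"
      using Comp T by (auto simp: gs ys list_all2_conv_all_nth code_length_eq code_nth_eq)
    moreover have "computes f' zs v" using Comp T by (simp add: f ys)
    ultimately show ?thesis unfolding F by (rule computes.intros(4))
  next
    case (PrimRec_0 f a w g)
    then obtain f' g' where F: "F = PrimRec f' g'" and f: "f = program_code f'"
      by (cases F) auto
    obtain ys where ys: "a = list_encode ys" "xs = 0 # ys"
      using PrimRec_0 by (auto simp: list_encode_eq_code_Cons)
    have "computes f' ys v" using PrimRec_0 by (auto simp: f ys intro!: T)
    then show ?thesis unfolding F ys by (rule computes.intros(5))
  next
    case (PrimRec_Suc f g n a u w)
    then obtain f' g' where F: "F = PrimRec f' g'"
      and f: "f = program_code f'" and g: "g = program_code g'"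
      by (cases F) auto
    obtain ys where ys: "a = list_encode ys" "xs = Suc n # ys"
      using PrimRec_Suc by (auto simp: list_encode_eq_code_Cons)
    have "computes F (n # ys) u" "computes g' (n # u # ys) v"
      using PrimRec_Suc by (auto simp: F f g ys intro!: T)
    then show ?thesis unfolding F ys by (rule computes.intros(6))
  next
    case (Mu f n a)
    then obtain f' where F: "F = Mu f'" and f: "f = program_code f'" by (cases F) auto
    have "computes f' (v # xs) 0" using Mu by (auto simp: f intro!: T)
    moreover have "\<forall>m<v. \<exists>k. computes f' (m # xs) (Suc k)"
    proof (intro allI impI)
      fix m assume "m < v"
      then obtain k where "true_judgement (judgement (program_code f') (list_encode (m # xs)) (Suc k))"
        using Mu by (auto simp: f)
      then show "\<exists>k. computes f' (m # xs) (Suc k)" using T by blast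
    qed
    ultimately show ?thesis unfolding F by (rule computes.intros(7))
  qed
qed

text \<open>
  A derivation lists judgements, each justified by later entries of the list. The premises have to
  come from strictly further down, since otherwise judgements could justify each other in a circle.
\<close>

definition derivation :: "nat list \<Rightarrow> bool" where
  "derivation D \<longleftrightarrow> (\<forall>i<length D. justified (\<lambda>j. j \<in> set (drop (Suc i) D)) (D ! i))"

definition derivable :: "nat \<Rightarrow> bool" where
  "derivable j \<longleftrightarrow> (\<exists>D. derivation D \<and> j \<in> set D)"

lemma derivation_Cons: "derivation (j # D) \<longleftrightarrow> justified (\<lambda>i. i \<in> set D) j \<and> derivation D"
  by (simp add: derivation_def All_less_Suc2)

lemma derivation_Nil: "derivation []"
  by (simp add: derivation_def)

lemma derivation_append: "derivation D \<Longrightarrow> derivation E \<Longrightarrow> derivation (D @ E)"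
  by (induction D) (auto simp: derivation_Cons intro: justified_mono)

lemma derivable_sound:
  assumes "derivable j" shows "true_judgement j"
proof -
  have "\<forall>j\<in>set D. true_judgement j" if "derivation D" for D
    using that
  proof (induction D)
    case (Cons j D)
    then have "justified true_judgement j" by (auto simp: derivation_Cons intro: justified_mono)
    with Cons show ?case by (auto simp: derivation_Cons intro: justified_sound)
  qed simp
  with assms show ?thesis unfolding derivable_def by blast
qed

text \<open>
  The rules for composition and for search have a finite but unbounded number of premises, whose
  derivations are concatenated.
\<close>

lemma derivable_finite:
  assumes "finite S" "\<And>j. j \<in> S \<Longrightarrow> derivable j"
  shows "\<exists>D. derivation D \<and> S \<subseteq> set D"
  using assms
proof (induction S rule: finite_induct)
  case empty
  then show ?case using derivation_Nil by auto
next
  case (insert j S)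
  then obtain D E where "derivation D" "S \<subseteq> set D" "derivation E" "j \<in> set E"
    unfolding derivable_def by blast
  then show ?case by (intro exI[of _ "D @ E"]) (auto intro: derivation_append)
qed

lemma derivable_justified:
  assumes "justified (\<lambda>i. i \<in> S) j" "finite S" "\<And>i. i \<in> S \<Longrightarrow> derivable i"
  shows "derivable j"
proof -
  obtain D where "derivation D" "S \<subseteq> set D" using derivable_finite assms(2,3) by metis
  with assms(1) have "derivation (j # D)" by (auto simp: derivation_Cons intro: justified_mono)
  then show ?thesis unfolding derivable_def by (intro exI[of _ "j # D"]) simp
qed

lemma derivable_complete:
  assumes "computes f xs v"
  shows "derivable (judgement (program_code f) (list_encode xs) v)"
  using assms
proof (induction rule: computes.induct)
  case (1 xs)
  show ?case by (rule derivable_justified[of "{}"]) (simp_all add: justified.Zero)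
next
  case (2 x xs)
  show ?case
    by (rule derivable_justified[of "{}"]) (use justified.Succ in auto)
next
  case (3 i xs)
  then have "justified (\<lambda>j. j \<in> {}) (judgement (prod_encode (2, i)) (list_encode xs) (xs ! i))"
    using justified.Proj[of i "list_encode xs"] by (simp add: code_length_eq code_nth_eq)
  then show ?case unfolding program_code.simps by (rule derivable_justified) simp_all
next
  case (4 xs gs ys f v)
  let ?S = "insert (judgement (program_code f) (list_encode ys) v)
    ((\<lambda>i. judgement (program_code (gs ! i)) (list_encode xs) (ys ! i)) ` {..<length gs})"
  have "length gs = length ys" using 4 by (auto dest: list_all2_lengthD)
  then have "justified (\<lambda>j. j \<in> ?S) (judgement (program_code (Comp f gs)) (list_encode xs) v)"
    by (auto intro!: justified.Comp[where ys = "list_encode ys"] simp: code_length_eq code_nth_eq)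
  then show ?case
    by (rule derivable_justified) (use 4 in \<open>auto simp: list_all2_conv_all_nth\<close>)
next
  case (5 f xs v g)
  let ?S = "{judgement (program_code f) (list_encode xs) v}"
  have "justified (\<lambda>j. j \<in> ?S) (judgement (program_code (PrimRec f g)) (list_encode (0 # xs)) v)"
    by (auto intro!: justified.PrimRec_0)
  then show ?case by (rule derivable_justified) (use 5 in auto)
next
  case (6 f g n xs u v)
  let ?S = "{judgement (program_code (PrimRec f g)) (list_encode (n # xs)) u,
    judgement (program_code g) (list_encode (n # u # xs)) v}"
  have "justified (\<lambda>j. j \<in> ?S) (judgement (program_code (PrimRec f g)) (list_encode (Suc n # xs)) v)"
    by (auto intro!: justified.PrimRec_Suc[where u = u])
  then show ?case by (rule derivable_justified) (use 6 in auto)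
next
  case (7 f n xs)
  have "\<forall>m<n. \<exists>k. derivable (judgement (program_code f) (list_encode (m # xs)) (Suc k))"
    using 7 by blast
  then obtain k where k:
    "\<And>m. m < n \<Longrightarrow> derivable (judgement (program_code f) (list_encode (m # xs)) (Suc (k m)))"
    by metis
  let ?S = "insert (judgement (program_code f) (list_encode (n # xs)) 0)
    ((\<lambda>m. judgement (program_code f) (list_encode (m # xs)) (Suc (k m))) ` {..<n})"
  have "justified (\<lambda>j. j \<in> ?S) (judgement (program_code (Mu f)) (list_encode xs) n)"
    by (auto intro!: justified.Mu)
  then show ?case by (rule derivable_justified) (use 7 k in auto)
qed

lemma derivable_iff_computes:
  "derivable (judgement (program_code f) (list_encode xs) v) \<longleftrightarrow> computes f xs v"
  using derivable_sound derivable_complete unfolding true_judgement_def by blast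

text \<open>
  A derivation is an unbounded witness. Everything else in the condition that it is one quantifies
  over positions in the list or has the shape of an existential formula, namely the right-hand side
  of \<open>justified.simps\<close>.
\<close>

lemma semidecidable_derivable:
  assumes "computable A" shows "semidecidable (\<lambda>e. derivable (A e))"
proof -
  let ?T = "\<lambda>d j. \<exists>k. k < code_length d \<and> code_nth d k = j"
  have T: "?T (list_encode D) j \<longleftrightarrow> j \<in> set D" for D j
    by (auto simp: code_length_eq code_nth_eq in_set_conv_nth cong: conj_cong)
  define checks where "checks d \<longleftrightarrow>
    (\<forall>i<code_length d. justified (?T (code_drop (Suc i) d)) (code_nth d i))" for d
  have checks: "checks (list_encode D) \<longleftrightarrow> derivation D" for D
    unfolding checks_def derivation_def code_drop_eq T by (simp add: code_length_eq code_nth_eq)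
  have "derivable j \<longleftrightarrow> (\<exists>d. checks d \<and> ?T d j)" for j
  proof
    assume "derivable j"
    then obtain D where "checks (list_encode D)" "?T (list_encode D) j"
      unfolding derivable_def checks T by blast
    then show "\<exists>d. checks d \<and> ?T d j" by blast
  next
    assume "\<exists>d. checks d \<and> ?T d j"
    then obtain d where d: "checks d" "?T d j" by blast
    obtain D where D: "d = list_encode D" using list_decode_inverse[of d] by metis
    show "derivable j" unfolding derivable_def using d[unfolded D checks T] by blast
  qed
  then have eq: "derivable = (\<lambda>j. \<exists>d. checks d \<and> ?T d j)" by (rule ext)
  have "semidecidable (\<lambda>e. derivable (e 0))"
    unfolding eq checks_def justified.simps judgement_def
    by (intro semidecidable_intros computable_list_intros)
  from semidecidable_subst[OF this, of "\<lambda>_. A"] assms show ?thesis by simp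
qed

text \<open>
  The pairs of a program and an argument \<open>x\<close> such that the program accepts \<open>(x, y)\<close> for some
  \<open>y\<close>. Every set \<open>{x. \<exists>y. R x y}\<close> with recursive \<open>R\<close> is a section of it.
\<close>

definition universal_set :: "nat set" where
  "universal_set = {z. \<exists>p x y. z = prod_encode (p, x) \<and>
     derivable (judgement p (code_Cons x (code_Cons y 0)) 1)}"

lemma sigma01_complete_universal_set: "sigma01_complete universal_set"
  unfolding sigma01_complete_def
proof (intro conjI allI impI)
  show "sigma01 universal_set"
    unfolding sigma01_semidecidable universal_set_def mem_Collect_eq judgement_def
    by (intro semidecidable_intros semidecidable_derivable computable_list_intros)
next
  fix A assume "sigma01 A"
  then obtain R r where A: "A = {x. \<exists>y. R x y}"
    and r: "\<And>x y. computes r [x, y] (if R x y then 1 else 0)"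
    unfolding sigma01_def recursive_relation_def by blast
  have "R x y \<longleftrightarrow> computes r [x, y] 1" for x y
    using r[of x y] computes_deterministic by (cases "R x y") fastforce+
  then have "R x y \<longleftrightarrow> derivable (judgement (program_code r) (code_Cons x (code_Cons y 0)) 1)" for x y
    using derivable_iff_computes[of r "[x, y]" 1] by simp
  then have "x \<in> A \<longleftrightarrow> prod_encode (program_code r, x) \<in> universal_set" for x
    by (simp add: A universal_set_def)
  moreover have "total_recursive (\<lambda>x. prod_encode (program_code r, x))"
    unfolding total_recursive_computable by (intro computable_intros)
  ultimately show "many_one_reducible A universal_set"
    unfolding many_one_reducible_def by blast
qed

section \<open>Subshifts given by forbidden words\<close>

definition avoiding :: "'a set \<Rightarrow> 'a list set \<Rightarrow> (int \<Rightarrow> 'a) set" where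
  "avoiding S F = {x \<in> topspace (full_shift S). \<forall>w\<in>F. \<not> occurs_in w x}"

lemma topspace_full_shift: "x \<in> topspace (full_shift S) \<longleftrightarrow> (\<forall>i. x i \<in> S)"
  by (auto simp: full_shift_def PiE_iff)

lemma block_shift_pow: "block ((shift ^^ j) x) i n = block x (i + int j) n"
proof (induction j arbitrary: i)
  case (Suc j)
  have "block (shift y) i n = block y (i + 1) n" for y :: "int \<Rightarrow> 'a" and i
    by (simp add: block_def shift_def algebra_simps)
  with Suc show ?case by (simp add: algebra_simps)
qed simp

lemma block_translate: "block (\<lambda>i. x (i + t)) i n = block x (i + t) n"
  by (simp add: block_def algebra_simps)

lemma length_block [simp]: "length (block x i n) = n"
  by (simp add: block_def)

lemma nth_block [simp]: "k < n \<Longrightarrow> block x i n ! k = x (i + int k)"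
  by (simp add: block_def)

lemma avoiding_translate: "(\<lambda>i. x (i + t)) \<in> avoiding S F \<longleftrightarrow> x \<in> avoiding S F"
proof -
  have "occurs_in w (\<lambda>i. x (i + t)) \<longleftrightarrow> occurs_in w x" for w
    unfolding occurs_in_def block_translate by (metis diff_add_cancel)
  moreover have "(\<forall>i. x (i + t) \<in> S) \<longleftrightarrow> (\<forall>i. x i \<in> S)" by (metis diff_add_cancel)
  ultimately show ?thesis by (simp add: avoiding_def topspace_full_shift)
qed

text \<open>
  Each single occurrence of a word is an open condition, even if there are infinitely many
  forbidden words.
\<close>

lemma closedin_avoiding: "closedin (full_shift S) (avoiding S F)"
proof -
  let ?T = "full_shift S"
  have coordinate: "openin ?T {x \<in> topspace ?T. x i = a}" for i a
  proof (cases "a \<in> S")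
    case True
    have "continuous_map ?T (discrete_topology S) (\<lambda>x. x i)"
      unfolding full_shift_def by (rule continuous_map_product_projection) simp
    from openin_continuous_map_preimage[OF this, of "{a}"] True show ?thesis by simp
  next
    case False
    then have "{x \<in> topspace ?T. x i = a} = {}" by (auto simp: topspace_full_shift)
    then show ?thesis by (simp only: openin_empty)
  qed
  have "openin ?T {x \<in> topspace ?T. block x i (length w) = w}" for i w
  proof -
    have "openin ?T (topspace ?T \<inter> (\<Inter>k<length w. {x \<in> topspace ?T. x (i + int k) = w ! k}))"
    proof (cases "length w = 0")
      case False
      then show ?thesis by (intro openin_Int openin_topspace openin_Inter) (auto intro: coordinate)
    qed simp
    moreover have "topspace ?T \<inter> (\<Inter>k<length w. {x \<in> topspace ?T. x (i + int k) = w ! k})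
        = {x \<in> topspace ?T. block x i (length w) = w}"
      by (auto simp: list_eq_iff_nth_eq)
    ultimately show ?thesis by simp
  qed
  then have "openin ?T (\<Union>w\<in>F. \<Union>i. {x \<in> topspace ?T. block x i (length w) = w})"
    by blast
  moreover have "topspace ?T - avoiding S F = (\<Union>w\<in>F. \<Union>i. {x \<in> topspace ?T. block x i (length w) = w})"
    by (auto simp: avoiding_def occurs_in_def)
  ultimately show ?thesis by (auto simp: closedin_def avoiding_def)
qed

lemma subshift_avoiding: "subshift S (avoiding S F)"
proof -
  have "shift ` avoiding S F = avoiding S F"
  proof
    show "shift ` avoiding S F \<subseteq> avoiding S F"
      using avoiding_translate[of _ 1] by (auto simp: shift_def)
    show "avoiding S F \<subseteq> shift ` avoiding S F"
    proof
      fix x assume "x \<in> avoiding S F"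
      then have "(\<lambda>i. x (i - 1)) \<in> avoiding S F" using avoiding_translate[of x "- 1"] by simp
      moreover have "x = shift (\<lambda>i. x (i - 1))" by (simp add: shift_def)
      ultimately show "x \<in> shift ` avoiding S F" by blast
    qed
  qed
  with closedin_avoiding show ?thesis by (auto simp: subshift_def)
qed

definition subword_at :: "'a list \<Rightarrow> nat \<Rightarrow> 'a list \<Rightarrow> bool" where
  "subword_at u p w \<longleftrightarrow> p + length w \<le> length u \<and> take (length w) (drop p u) = w"

lemma subword_at_nth:
  "subword_at u p w \<longleftrightarrow> p + length w \<le> length u \<and> (\<forall>k<length w. u ! (p + k) = w ! k)"
  by (auto simp: subword_at_def list_eq_iff_nth_eq)

lemma subword_at_block:
  assumes "p + n \<le> m" shows "subword_at (block x i m) p (block x (i + int p) n)"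
  using assms by (auto simp: subword_at_nth algebra_simps)

lemma subword_at_blockD:
  "subword_at (block x i m) p w \<Longrightarrow> block x (i + int p) (length w) = w"
  by (rule nth_equalityI) (auto simp: subword_at_nth algebra_simps)

text \<open>
  A word is extended to a point by repeating its first letter to the left and its last letter to
  the right. No new letter change is created, so that a forbidden word which changes its
  letter in its first and in its last step can occur only inside the given word. Therefore every
  word that avoids such forbidden words belongs to the language, and no search for extensions is
  needed to decide it.
\<close>

definition clamp :: "'a list \<Rightarrow> int \<Rightarrow> 'a" where
  "clamp u i = u ! nat (max 0 (min i (int (length u) - 1)))"

lemma block_clamp: "block (clamp u) 0 (length u) = u"
  by (rule nth_equalityI) (auto simp: clamp_def max_def min_def)

lemma language_avoiding:
  assumes "S \<noteq> {}" and ends: "\<And>w. w \<in> F \<Longrightarrow> length w \<ge> 2 \<and> w ! 0 \<noteq> w ! 1 \<and>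
    w ! (length w - 2) \<noteq> w ! (length w - 1)"
  shows "language (avoiding S F) = {u \<in> lists S. \<forall>w\<in>F. \<forall>p. \<not> subword_at u p w}"
proof (intro equalityI subsetI)
  fix u assume "u \<in> language (avoiding S F)"
  then obtain x i where x: "x \<in> avoiding S F" and u: "block x i (length u) = u"
    unfolding language_def occurs_in_def by blast
  have "u ! k \<in> S" if "k < length u" for k
  proof -
    have "u ! k = x (i + int k)" using that u by (metis nth_block)
    with x show ?thesis by (simp add: avoiding_def topspace_full_shift)
  qed
  then have "u \<in> lists S" by (auto simp: in_set_conv_nth)
  moreover have "\<not> subword_at u p w" if "w \<in> F" for w p
  proof
    assume "subword_at u p w"
    then have "subword_at (block x i (length u)) p w" using u by simp
    then have "occurs_in w x" unfolding occurs_in_def using subword_at_blockD by blast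
    with x that show False by (simp add: avoiding_def)
  qed
  ultimately show "u \<in> {u \<in> lists S. \<forall>w\<in>F. \<forall>p. \<not> subword_at u p w}" by blast
next
  fix u assume "u \<in> {u \<in> lists S. \<forall>w\<in>F. \<forall>p. \<not> subword_at u p w}"
  then have u: "u \<in> lists S" "\<And>w p. w \<in> F \<Longrightarrow> \<not> subword_at u p w" by auto
  show "u \<in> language (avoiding S F)"
  proof (cases "u = []")
    case True
    obtain a where "a \<in> S" using assms(1) by blast
    have "\<not> occurs_in w (\<lambda>_. a)" if "w \<in> F" for w
    proof
      assume "occurs_in w (\<lambda>_. a)"
      then obtain i where "block (\<lambda>_. a) i (length w) = w" unfolding occurs_in_def by blast
      then have const: "w ! k = a" if "k < length w" for k using that by (metis nth_block)
      have "0 < length w" "1 < length w" using ends[OF that] by linarith+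
      then have "w ! 0 = w ! 1" using const by metis
      with ends[OF that] show False by simp
    qed
    then have "(\<lambda>_. a) \<in> avoiding S F" using \<open>a \<in> S\<close> by (simp add: avoiding_def topspace_full_shift)
    moreover have "occurs_in u (\<lambda>_. a)" using True by (simp add: occurs_in_def block_def)
    ultimately show ?thesis unfolding language_def by blast
  next
    case False
    have "\<not> occurs_in w (clamp u)" if "w \<in> F" for w
    proof
      assume "occurs_in w (clamp u)"
      then obtain i where i: "block (clamp u) i (length w) = w" unfolding occurs_in_def by blast
      then have w: "w ! k = clamp u (i + int k)" if "k < length w" for k
        using that by (metis nth_block)
      have n: "length w \<ge> 2" using ends[OF that] by simp
      have "w ! 0 = clamp u (i + int 0)" "w ! 1 = clamp u (i + int 1)"
        "w ! (length w - 2) = clamp u (i + int (length w - 2))"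
        "w ! (length w - 1) = clamp u (i + int (length w - 1))"
        by (rule w, use n in linarith)+
      with ends[OF that] n have left: "clamp u i \<noteq> clamp u (i + 1)"
        and right: "clamp u (i + int (length w) - 2) \<noteq> clamp u (i + int (length w) - 1)"
        by (simp_all add: of_nat_diff algebra_simps)
      from left have "0 \<le> i" unfolding clamp_def by (cases "0 \<le> i") auto
      from right have le: "i + int (length w) \<le> int (length u)"
        unfolding clamp_def by (cases "i + int (length w) \<le> int (length u)") auto
      have "nat i + length w \<le> length u" using le \<open>0 \<le> i\<close> by linarith
      then have "subword_at (block (clamp u) 0 (length u)) (nat i) (block (clamp u) (0 + int (nat i)) (length w))"
        by (rule subword_at_block)
      then have "subword_at u (nat i) w" using i \<open>0 \<le> i\<close> by (simp add: block_clamp)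
      with u(2)[OF that] show False by blast
    qed
    moreover have "clamp u i \<in> S" for i
    proof -
      have "0 < length u" using False by simp
      then have "nat (max 0 (min i (int (length u) - 1))) < length u" by linarith
      then have "clamp u i \<in> set u" unfolding clamp_def by (rule nth_mem)
      then show ?thesis using u(1) by auto
    qed
    ultimately have "clamp u \<in> avoiding S F" by (simp add: avoiding_def topspace_full_shift)
    moreover have "occurs_in u (clamp u)" unfolding occurs_in_def using block_clamp by blast
    ultimately show ?thesis unfolding language_def by blast
  qed
qed

text \<open>
  A point which visits two clopen sets shows both visits inside one word. Since the subshift is
  invariant under translations, only the relative position of the two visits matters, and the
  condition that the second visit does not precede the first becomes an inequality of offsets.
\<close>

lemma visits_iff_subwords:
  assumes C: "C \<subseteq> {w \<in> lists S. length w = m}" and D: "D \<subseteq> {w \<in> lists S. length w = n}"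
  shows "(\<exists>x\<in>avoiding S F. \<exists>j::nat. x \<in> clopen S k m C \<and> (shift ^^ j) x \<in> clopen S l n D) \<longleftrightarrow>
    (\<exists>u\<in>language (avoiding S F). \<exists>v\<in>C. \<exists>w\<in>D. \<exists>p q. subword_at u p v \<and> subword_at u q w \<and>
       l + int p \<le> k + int q)" (is "?L \<longleftrightarrow> ?R")
proof
  assume ?L
  then obtain x j where x: "x \<in> avoiding S F" and v: "block x k m \<in> C"
    and w: "block x (l + int j) n \<in> D"
    unfolding clopen_def by (auto simp: block_shift_pow)
  \<comment> \<open>The window of length \<open>N\<close> from \<open>s\<close> is the smallest one that covers both visits.\<close>
  define s where "s = min k (l + int j)"
  define N where "N = nat (max (k + int m) (l + int j + int n) - s)"
  define p q where "p = nat (k - s)" and "q = nat (l + int j - s)"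
  have pq: "s + int p = k" "s + int q = l + int j" by (auto simp: p_def q_def s_def)
  have "p + m \<le> N" "q + n \<le> N" using pq unfolding N_def by linarith+
  then have "subword_at (block x s N) p (block x k m)" "subword_at (block x s N) q (block x (l + int j) n)"
    using subword_at_block[of p m N x s] subword_at_block[of q n N x s] by (simp_all add: pq)
  moreover have "block x s N \<in> language (avoiding S F)"
    unfolding language_def occurs_in_def using x by auto
  moreover have "l + int p \<le> k + int q" using pq by linarith
  ultimately show ?R using v w by blast
next
  assume ?R
  then obtain u v w p q where u: "u \<in> language (avoiding S F)" and "v \<in> C" "w \<in> D"
    and vw: "subword_at u p v" "subword_at u q w" and le: "l + int p \<le> k + int q"
    by blast
  have len: "length v = m" "length w = n" using C D \<open>v \<in> C\<close> \<open>w \<in> D\<close> by auto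
  obtain x s where x: "x \<in> avoiding S F" and s: "block x s (length u) = u"
    using u unfolding language_def occurs_in_def by blast
  have v: "block x (s + int p) m = v" and w: "block x (s + int q) n = w"
    using subword_at_blockD[of x s "length u"] vw by (simp_all add: s flip: len)
  \<comment> \<open>The translation by \<open>t\<close> moves the first visit to the prescribed coordinate \<open>k\<close>.\<close>
  define t where "t = s + int p - k"
  define j where "j = nat (k + int q - l - int p)"
  define y where "y = (\<lambda>i. x (i + t))"
  have y: "y \<in> avoiding S F" unfolding y_def avoiding_translate by (rule x)
  have "block y k m = v" unfolding y_def block_translate t_def using v by simp
  moreover have "block ((shift ^^ j) y) l n = w"
  proof -
    have "l + int j + t = s + int q" using le unfolding j_def t_def by simp
    then show ?thesis unfolding block_shift_pow y_def block_translate using w by simp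
  qed
  moreover have "(shift ^^ i) y \<in> avoiding S F" for i
    using y subshift_avoiding[of S F] by (induction i) (auto simp: subshift_def)
  then have "(shift ^^ i) y \<in> topspace (full_shift S)" for i by (auto simp: avoiding_def)
  from this[of 0] this[of j] have "y \<in> topspace (full_shift S)" "(shift ^^ j) y \<in> topspace (full_shift S)"
    by simp_all
  ultimately show ?L using y \<open>v \<in> C\<close> \<open>w \<in> D\<close> unfolding clopen_def by blast
qed

section \<open>Nondecreasing points\<close>

definition descents :: "nat list set" where
  "descents = {[a, b] | a b. a \<in> {0, 1, 2, 3} \<and> b \<in> {0, 1, 2, 3} \<and> b < a}"

lemma avoiding_descents_mono:
  assumes "x \<in> avoiding {0, 1, 2, 3} F" "descents \<subseteq> F" shows "mono x"
proof -
  have range: "x i \<in> {0, 1, 2, 3}" for i using assms(1) by (auto simp: avoiding_def topspace_full_shift)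
  have step: "x i \<le> x (i + 1)" for i
  proof (rule ccontr)
    assume "\<not> x i \<le> x (i + 1)"
    then have "[x i, x (i + 1)] \<in> descents" using range[of i] range[of "i + 1"] unfolding descents_def by auto
    moreover have "occurs_in [x i, x (i + 1)] x"
      unfolding occurs_in_def by (intro exI[of _ i]) (simp add: block_def upt_rec)
    ultimately show False using assms by (auto simp: avoiding_def)
  qed
  have "x i \<le> x (i + int n)" for i n
  proof (induction n)
    case (Suc n)
    with step[of "i + int n"] show ?case by (simp add: algebra_simps)
  qed simp
  then show ?thesis by (intro monoI) (metis add.commute diff_add_cancel nonneg_int_cases diff_ge_0_iff_ge)
qed

text \<open>
  A nondecreasing point with finitely many values is a sum of indicator functions of up-sets of the
  integers, and there are only countably many of these.
\<close>

lemma countable_mono_points: "countable {x :: int \<Rightarrow> nat. mono x \<and> (\<forall>i. x i \<le> 3)}"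
proof -
  define \<U> :: "int set set" where "\<U> = insert {} (insert UNIV (range atLeast))"
  have upset: "U \<in> \<U>" if up: "\<And>i j. i \<in> U \<Longrightarrow> i \<le> j \<Longrightarrow> j \<in> U" for U :: "int set"
  proof (cases "U = {} \<or> U = UNIV")
    case False
    then obtain a b where "a \<in> U" "b \<notin> U" by blast
    have below: "b < i" if "i \<in> U" for i using up[OF that, of b] \<open>b \<notin> U\<close> by (meson not_less)
    \<comment> \<open>The least element of \<open>U\<close>, searched upwards from the lower bound \<open>b\<close>.\<close>
    define c where "c = b + int (LEAST n. b + int n \<in> U)"
    have "\<exists>n. b + int n \<in> U"
      using \<open>a \<in> U\<close> below[of a] by (intro exI[of _ "nat (a - b)"]) simp
    then have "c \<in> U" unfolding c_def by (rule LeastI_ex)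
    have "c \<le> i" if "i \<in> U" for i
    proof -
      have "b + int (nat (i - b)) \<in> U" using that below[OF that] by simp
      then have "(LEAST n. b + int n \<in> U) \<le> nat (i - b)" by (rule Least_le)
      then show ?thesis using below[OF that] unfolding c_def by linarith
    qed
    with \<open>c \<in> U\<close> up have "U = {c..}" by auto
    then show ?thesis by (simp add: \<U>_def)
  qed (auto simp: \<U>_def)
  define f :: "int set \<times> int set \<times> int set \<Rightarrow> int \<Rightarrow> nat" where
    "f = (\<lambda>(A, B, C) i. of_bool (i \<in> A) + of_bool (i \<in> B) + of_bool (i \<in> C))"
  have "x \<in> f ` (\<U> \<times> \<U> \<times> \<U>)" if "mono x" "\<forall>i. x i \<le> 3" for x :: "int \<Rightarrow> nat"
  proof -
    have U: "{i. a \<le> x i} \<in> \<U>" for a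
      by (rule upset) (use monoD[OF \<open>mono x\<close>] order_trans in blast)
    have "x = f ({i. 1 \<le> x i}, {i. 2 \<le> x i}, {i. 3 \<le> x i})"
    proof
      fix i
      have "x i \<le> 3" using that(2) by blast
      then consider "x i = 0" | "x i = 1" | "x i = 2" | "x i = 3" by linarith
      then show "x i = f ({i. 1 \<le> x i}, {i. 2 \<le> x i}, {i. 3 \<le> x i}) i" by cases (simp_all add: f_def)
    qed
    with U show ?thesis by blast
  qed
  then have "{x. mono x \<and> (\<forall>i. x i \<le> 3)} \<subseteq> f ` (\<U> \<times> \<U> \<times> \<U>)" by blast
  moreover have "countable \<U>" unfolding \<U>_def by auto
  then have "countable (f ` (\<U> \<times> \<U> \<times> \<U>))" by (intro countable_image countable_SIGMA)
  ultimately show ?thesis by (rule countable_subset)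
qed

text \<open>
  Shifting a nondecreasing bounded point to the left converges to a unary point, so that every
  nonempty subsystem contains one.
\<close>

lemma unary_point_in_subshift:
  assumes "subshift S Y" "x \<in> Y" "mono x" "\<And>i. x i \<le> (b::nat)"
  obtains a where "a \<in> range x" "unary_point a \<in> Y"
proof -
  have fin: "finite (range x)" using assms(4) finite_subset[of "range x" "{..b}"] by auto
  define a where "a = Max (range x)"
  have "a \<in> range x" unfolding a_def using fin by (intro Max_in) auto
  then obtain N where N: "x N = a" by auto
  have ge: "x i = a" if "N \<le> i" for i
    using monoD[OF assms(3) that] N Max_ge[OF fin, of "x i"] by (simp add: a_def)
  have iter: "(shift ^^ j) x \<in> Y" for j
    using assms(1,2) by (induction j) (auto simp: subshift_def)
  have closed: "closedin (full_shift S) Y" using assms(1) by (simp add: subshift_def)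
  have xS: "x i \<in> S" for i
    using closedin_subset[OF closed] assms(2) topspace_full_shift by blast
  have "unary_point a \<in> Y"
  proof (rule ccontr)
    assume "unary_point a \<notin> Y"
    moreover have "unary_point a \<in> topspace (full_shift S)"
      using xS[of N] N by (simp add: topspace_full_shift unary_point_def)
    ultimately have "unary_point a \<in> topspace (full_shift S) - Y" by blast
    moreover have "openin (full_shift S) (topspace (full_shift S) - Y)"
      using closed by blast
    ultimately obtain U where U: "finite {i \<in> UNIV. U i \<noteq> topspace (discrete_topology S)}"
      "unary_point a \<in> Pi\<^sub>E UNIV U" "Pi\<^sub>E UNIV U \<subseteq> topspace (full_shift S) - Y"
      unfolding full_shift_def openin_product_topology_alt by (elim ballE exE conjE) auto
    \<comment> \<open>After \<open>M\<close> shifts, all coordinates that the basic neighbourhood restricts show \<open>a\<close>.\<close>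
    define M where "M = Max (insert 0 ((\<lambda>i. nat (N - i)) ` {i. U i \<noteq> S}))"
    have "(shift ^^ M) x i \<in> U i" for i
    proof (cases "U i = S")
      case True
      have "(shift ^^ M) x \<in> topspace (full_shift S)" using iter closedin_subset[OF closed] by blast
      then show ?thesis by (simp add: True topspace_full_shift)
    next
      case False
      then have "nat (N - i) \<le> M" unfolding M_def using U(1) by (intro Max_ge) auto
      then have "x (i + int M) = a" by (intro ge) linarith
      moreover have "(shift ^^ M) x i = x (i + int M)"
        using block_shift_pow[of M x i 1] by (simp add: block_def)
      ultimately show ?thesis using U(2) by (simp add: unary_point_def PiE_iff)
    qed
    then have "(shift ^^ M) x \<in> Pi\<^sub>E UNIV U" by (simp add: PiE_iff)
    with U(3) iter show False by blast
  qed
  with \<open>a \<in> range x\<close> that show thesis by blast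
qed

lemma subshift_unary_point:
  assumes "a \<in> S" shows "subshift S {unary_point a}"
proof -
  have "x = unary_point a" if "x \<in> avoiding S {[b] | b. b \<noteq> a}" for x
  proof
    fix i
    have "occurs_in [x i] x" unfolding occurs_in_def by (intro exI[of _ i]) (simp add: block_def)
    with that show "x i = unary_point a i" by (auto simp: avoiding_def unary_point_def)
  qed
  moreover have "unary_point a \<in> avoiding S {[b] | b. b \<noteq> a}"
    using assms by (auto simp: avoiding_def topspace_full_shift unary_point_def occurs_in_def block_def)
  ultimately have "avoiding S {[b] | b. b \<noteq> a} = {unary_point a}" by blast
  with subshift_avoiding[of S "{[b] | b. b \<noteq> a}"] show ?thesis by (simp only:)
qed

section \<open>The subshift of a relation\<close>

text \<open>
  In a nondecreasing point which contains both \<open>0\<close> and \<open>3\<close>, the numbers \<open>m\<close> of letters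
  \<open>1\<close> and \<open>n\<close> of letters \<open>2\<close> are finite, and the words below allow such a point only if
  \<open>R m (n - 1)\<close> holds. The shift by one makes room for at least one letter \<open>2\<close>, which marks
  the end of the block of letters \<open>1\<close>.
\<close>

definition mismatches :: "(nat \<Rightarrow> nat \<Rightarrow> bool) \<Rightarrow> nat list set" where
  "mismatches R = {0 # replicate m 1 @ replicate n 2 @ [3] | m n. \<not> R m (n - 1)}"

definition relation_shift :: "(nat \<Rightarrow> nat \<Rightarrow> bool) \<Rightarrow> (int \<Rightarrow> nat) set" where
  "relation_shift R = avoiding {0, 1, 2, 3} (descents \<union> mismatches R)"

lemma letters_iff: "x \<in> {0, 1, 2, 3} \<longleftrightarrow> x \<le> (3::nat)"
  by auto

text \<open>
  Membership in the language, in terms of the length \<open>l\<close> of a word and its letters \<open>f\<close>, so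
  that the same formula serves for lists and for their codes. All quantifiers are bounded by \<open>l\<close>,
  which makes it decidable.
\<close>

definition legal :: "(nat \<Rightarrow> nat \<Rightarrow> bool) \<Rightarrow> nat \<Rightarrow> (nat \<Rightarrow> nat) \<Rightarrow> bool" where
  "legal R l f \<longleftrightarrow>
     (\<forall>i<l. f i \<le> 3) \<and>
     (\<forall>i<l. Suc i < l \<longrightarrow> f i \<le> f (Suc i)) \<and>
     (\<forall>p<l. \<forall>m<l. \<forall>n<l. Suc (p + m + n) < l \<and> f p = 0 \<and> (\<forall>i<m. f (Suc (p + i)) = 1) \<and>
        (\<forall>i<n. f (Suc (p + m + i)) = 2) \<and> f (Suc (p + m + n)) = 3 \<longrightarrow> R m (n - 1))"

lemma legal_cong:
  assumes "\<And>i. i < l \<Longrightarrow> f i = g i" shows "legal R l f \<longleftrightarrow> legal R l g"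
proof -
  have "legal R l g" if "legal R l f" "\<And>i. i < l \<Longrightarrow> f i = g i" for f g
  proof -
    have "\<forall>i<m. f (Suc (p + i)) = 1" if "Suc (p + m + n) < l" "\<forall>i<m. g (Suc (p + i)) = 1" for p m n
      using that \<open>\<And>i. i < l \<Longrightarrow> f i = g i\<close> by simp
    moreover have "\<forall>i<n. f (Suc (p + m + i)) = 2"
      if "Suc (p + m + n) < l" "\<forall>i<n. g (Suc (p + m + i)) = 2" for p m n
      using that \<open>\<And>i. i < l \<Longrightarrow> f i = g i\<close> by simp
    ultimately show ?thesis using that unfolding legal_def by simp
  qed
  from this[of f g] this[of g f] assms show ?thesis by auto
qed

lemma subword_at_Nil: "subword_at u p [] \<longleftrightarrow> p \<le> length u"
  by (simp add: subword_at_def)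

lemma subword_at_Cons:
  "subword_at u p (a # w) \<longleftrightarrow> p < length u \<and> u ! p = a \<and> subword_at u (Suc p) w"
  by (auto simp: subword_at_nth All_less_Suc2)

lemma subword_at_append:
  "subword_at u p (v @ w) \<longleftrightarrow> subword_at u p v \<and> subword_at u (p + length v) w"
  by (auto simp: subword_at_def take_add add.commute add.left_commute)

lemma subword_at_replicate:
  "subword_at u p (replicate m a) \<longleftrightarrow> p + m \<le> length u \<and> (\<forall>i<m. u ! (p + i) = a)"
  by (simp add: subword_at_nth)

lemma subword_at_mismatch:
  "subword_at u p (0 # replicate m 1 @ replicate n 2 @ [3]) \<longleftrightarrow>
     Suc (p + m + n) < length u \<and> u ! p = 0 \<and> (\<forall>i<m. u ! Suc (p + i) = 1) \<and>
     (\<forall>i<n. u ! Suc (p + m + i) = 2) \<and> u ! Suc (p + m + n) = (3::nat)"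
  by (auto simp: subword_at_Cons subword_at_append subword_at_replicate subword_at_Nil algebra_simps)

lemma language_relation_shift:
  "language (relation_shift R) = {u. legal R (length u) (nth u)}"
proof -
  have "language (relation_shift R) =
      {u \<in> lists {0, 1, 2, 3}. \<forall>w\<in>descents \<union> mismatches R. \<forall>p. \<not> subword_at u p w}"
    unfolding relation_shift_def
  proof (rule language_avoiding)
    fix w assume "w \<in> descents \<union> mismatches R"
    then show "length w \<ge> 2 \<and> w ! 0 \<noteq> w ! 1 \<and> w ! (length w - 2) \<noteq> w ! (length w - 1)"
    proof
      assume "w \<in> descents"
      then show ?thesis by (auto simp: descents_def)
    next
      assume "w \<in> mismatches R"
      then obtain m n where w: "w = 0 # replicate m 1 @ replicate n 2 @ [3]"
        unfolding mismatches_def by blast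
      have "subword_at w 0 w" by (simp add: subword_at_nth)
      then have "w ! 0 = 0" "\<forall>i<m. w ! Suc i = 1" "\<forall>i<n. w ! Suc (m + i) = 2" "w ! Suc (m + n) = 3"
        using subword_at_mismatch[of w 0 m n] w by simp_all
      moreover have "length w = Suc (Suc (m + n))" by (simp add: w)
      ultimately show ?thesis
        by (cases m; cases n) (auto simp: numeral_2_eq_2)
    qed
  qed simp
  moreover have "u \<in> lists {0, 1, 2, 3} \<and> (\<forall>w\<in>descents \<union> mismatches R. \<forall>p. \<not> subword_at u p w)
      \<longleftrightarrow> legal R (length u) (nth u)" for u
  proof -
    have lists: "u \<in> lists {0, 1, 2, 3} \<longleftrightarrow> (\<forall>i<length u. u ! i \<le> 3)"
      unfolding in_lists_conv_set letters_iff by (simp add: all_set_conv_all_nth)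
    have pair: "subword_at u p [a, b] \<longleftrightarrow> Suc p < length u \<and> u ! p = a \<and> u ! Suc p = b" for p a b
      by (auto simp: subword_at_Cons subword_at_Nil)
    have descents: "(\<forall>w\<in>descents. \<forall>p. \<not> subword_at u p w) \<longleftrightarrow>
        (\<forall>i<length u. Suc i < length u \<longrightarrow> u ! i \<le> u ! Suc i)"
      if range: "\<forall>i<length u. u ! i \<le> 3"
    proof
      assume avoid: "\<forall>w\<in>descents. \<forall>p. \<not> subword_at u p w"
      show "\<forall>i<length u. Suc i < length u \<longrightarrow> u ! i \<le> u ! Suc i"
      proof (intro allI impI, rule ccontr)
        fix i assume i: "i < length u" "Suc i < length u" "\<not> u ! i \<le> u ! Suc i"
        then have "[u ! i, u ! Suc i] \<in> descents"
          unfolding descents_def letters_iff using range by simp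
        moreover have "subword_at u i [u ! i, u ! Suc i]" using i by (simp add: pair)
        ultimately show False using avoid by blast
      qed
    next
      assume step: "\<forall>i<length u. Suc i < length u \<longrightarrow> u ! i \<le> u ! Suc i"
      show "\<forall>w\<in>descents. \<forall>p. \<not> subword_at u p w"
      proof (intro ballI allI notI)
        fix w p assume "w \<in> descents" "subword_at u p w"
        then obtain a b where "b < a" "Suc p < length u" "u ! p = a" "u ! Suc p = b"
          unfolding descents_def by (auto simp: pair)
        with step show False by (meson Suc_lessD not_less)
      qed
    qed
    have mismatches: "(\<forall>w\<in>mismatches R. \<forall>p. \<not> subword_at u p w) \<longleftrightarrow>
        (\<forall>p<length u. \<forall>m<length u. \<forall>n<length u. Suc (p + m + n) < length u \<and> u ! p = 0 \<and>
          (\<forall>i<m. u ! Suc (p + i) = 1) \<and> (\<forall>i<n. u ! Suc (p + m + i) = 2) \<and>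
          u ! Suc (p + m + n) = 3 \<longrightarrow> R m (n - 1))" (is "_ \<longleftrightarrow> ?bounded")
    proof -
      have "(\<forall>w\<in>mismatches R. \<forall>p. \<not> subword_at u p w) \<longleftrightarrow>
          (\<forall>p m n. subword_at u p (0 # replicate m 1 @ replicate n 2 @ [3]) \<longrightarrow> R m (n - 1))"
        unfolding mismatches_def by blast
      also have "\<dots> \<longleftrightarrow> ?bounded"
        unfolding subword_at_mismatch
      proof (intro iffI allI impI)
        fix p m n
        assume bounded: ?bounded and u: "Suc (p + m + n) < length u \<and> u ! p = 0 \<and>
          (\<forall>i<m. u ! Suc (p + i) = 1) \<and> (\<forall>i<n. u ! Suc (p + m + i) = 2) \<and> u ! Suc (p + m + n) = 3"
        then have "p < length u" "m < length u" "n < length u" by linarith+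
        with bounded u show "R m (n - 1)" by blast
      qed blast
      finally show ?thesis .
    qed
    show ?thesis unfolding legal_def ball_Un lists mismatches using descents by blast
  qed
  ultimately show ?thesis by auto
qed

lemma decidable_legal:
  assumes R: "decidable (\<lambda>e. R (e 0) (e 1))" and "computable A"
  shows "decidable (\<lambda>e. legal R (code_length (A e)) (code_nth (A e)))"
proof -
  have "decidable (\<lambda>e. legal R (code_length (e 0)) (code_nth (e 0)))"
    unfolding legal_def
    by (intro decidable_subst_fun2[OF R] decidable_intros computable_list_intros)
  from decidable_subst[OF this, of "\<lambda>_. A"] assms(2) show ?thesis by simp
qed

lemma legal_code:
  "legal R (code_length (list_encode u)) (code_nth (list_encode u)) \<longleftrightarrow> legal R (length u) (nth u)"
  unfolding code_length_eq by (rule legal_cong) (simp add: code_nth_eq)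

lemma recursive_relation_shift:
  assumes "recursive_relation R"
  shows "recursive_subshift {0, 1, 2, 3} (relation_shift R)"
proof -
  have "z \<in> list_encode ` language (relation_shift R) \<longleftrightarrow> legal R (code_length z) (code_nth z)" for z
  proof -
    obtain u where z: "z = list_encode u" using list_decode_inverse[of z] by metis
    show ?thesis unfolding z legal_code language_relation_shift by (auto simp: list_encode_eq)
  qed
  moreover have "decidable (\<lambda>e. legal R (code_length (e 0)) (code_nth (e 0)))"
    using assms unfolding recursive_relation_decidable by (intro decidable_legal computable_var)
  ultimately show ?thesis
    unfolding recursive_subshift_def recursive_set_decidable
    using subshift_avoiding by (auto simp: relation_shift_def)
qed

lemma relation_shift_in_countable_SFT:
  "\<exists>Z. SFT {0, 1, 2, 3} Z \<and> countable Z \<and> relation_shift R \<subseteq> Z"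
proof (intro exI conjI)
  show "SFT {0, 1, 2, 3} (avoiding {0, 1, 2, 3} descents)"
    unfolding SFT_def
  proof (intro conjI exI)
    have "descents \<subseteq> (\<lambda>(a, b). [a, b]) ` ({0, 1, 2, 3} \<times> {0, 1, 2, 3})"
      unfolding descents_def by fast
    then show "finite descents" by (rule finite_subset) simp
    show "descents \<subseteq> lists {0, 1, 2, 3}" unfolding descents_def by auto
  qed (rule subshift_avoiding avoiding_def)+
  have "avoiding {0, 1, 2, 3} descents \<subseteq> {x. mono x \<and> (\<forall>i. x i \<le> 3)}"
    using avoiding_descents_mono[of _ descents]
    by (auto simp: avoiding_def topspace_full_shift simp flip: letters_iff)
  then show "countable (avoiding {0, 1, 2, 3} descents)"
    using countable_mono_points countable_subset by blast
  show "relation_shift R \<subseteq> avoiding {0, 1, 2, 3} descents"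
    by (auto simp: relation_shift_def avoiding_def)
qed

lemma minimal_subsystem_relation_shift:
  assumes "minimal_subsystem {0, 1, 2, 3} (relation_shift R) Y"
  shows "\<exists>a\<in>{0, 1, 2, 3}. Y = {unary_point a}"
proof -
  have Y: "subshift {0, 1, 2, 3} Y" "Y \<subseteq> relation_shift R" "Y \<noteq> {}"
    and minimal: "\<And>Z. subshift {0, 1, 2, 3} Z \<Longrightarrow> Z \<subseteq> Y \<Longrightarrow> Z = {} \<or> Z = Y"
    using assms unfolding minimal_subsystem_def by auto
  obtain x where x: "x \<in> Y" using Y(3) by blast
  then have "x \<in> avoiding {0, 1, 2, 3} (descents \<union> mismatches R)"
    using Y(2) by (auto simp: relation_shift_def)
  then have "mono x" and range: "\<And>i. x i \<in> {0, 1, 2, 3}"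
    by (rule avoiding_descents_mono, simp) (use \<open>x \<in> avoiding _ _\<close> in \<open>simp add: avoiding_def topspace_full_shift\<close>)
  then obtain a where a: "a \<in> range x" "unary_point a \<in> Y"
    using unary_point_in_subshift[OF Y(1) x \<open>mono x\<close>, of 3] letters_iff by metis
  then obtain i where "a = x i" by blast
  then have "a \<in> {0, 1, 2, 3}" using range by simp
  with minimal[OF subshift_unary_point] a show ?thesis by blast
qed

section \<open>The halting problem of the subshift\<close>

text \<open>
  The halting problem is expressed on codes by a formula whose unbounded quantifiers are all
  existential. The words in an instance must be checked to be of one length, which the first of them
  determines.
\<close>

definition uniform_code :: "nat \<Rightarrow> bool" where
  "uniform_code c \<longleftrightarrow> (\<forall>i<code_length c. code_length (code_nth c i) = code_length (code_nth c 0) \<and>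
     (\<forall>j<code_length (code_nth c i). code_nth (code_nth c i) j \<le> 3))"

lemma uniform_code_iff:
  "uniform_code (list_encode (map list_encode C)) \<longleftrightarrow>
     (\<exists>n. set C \<subseteq> {w \<in> lists {0, 1, 2, 3}. length w = n})"
proof -
  have lists: "w \<in> lists {0, 1, 2, 3} \<longleftrightarrow> (\<forall>j<length w. w ! j \<le> 3)" for w :: "nat list"
    unfolding in_lists_conv_set letters_iff by (simp add: all_set_conv_all_nth)
  have "uniform_code (list_encode (map list_encode C)) \<longleftrightarrow>
      (\<forall>i<length C. length (C ! i) = code_length (code_nth (list_encode (map list_encode C)) 0) \<and>
        C ! i \<in> lists {0, 1, 2, 3})"
    unfolding uniform_code_def lists by (simp add: code_length_eq code_nth_eq)
  also have "\<dots> \<longleftrightarrow> (\<forall>w\<in>set C. length w = length (C ! 0) \<and> w \<in> lists {0, 1, 2, 3})"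
  proof (cases "C = []")
    case False
    then have "code_length (code_nth (list_encode (map list_encode C)) 0) = length (C ! 0)"
      by (simp add: code_length_eq code_nth_eq)
    then show ?thesis by (simp add: all_set_conv_all_nth)
  qed simp
  also have "\<dots> \<longleftrightarrow> (\<exists>n. set C \<subseteq> {w \<in> lists {0, 1, 2, 3}. length w = n})"
  proof (cases "C = []")
    case False
    then have "C ! 0 \<in> set C" by simp
    then show ?thesis by blast
  qed simp
  finally show ?thesis .
qed

definition subword_code :: "nat \<Rightarrow> nat \<Rightarrow> nat \<Rightarrow> bool" where
  "subword_code u p w \<longleftrightarrow> p + code_length w \<le> code_length u \<and>
     (\<forall>i<code_length w. code_nth u (p + i) = code_nth w i)"

lemma subword_code_iff: "subword_code (list_encode u) p (list_encode w) \<longleftrightarrow> subword_at u p w"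
  unfolding subword_code_def subword_at_nth by (auto simp: code_length_eq code_nth_eq)

text \<open>
  The integer coded by \<open>c\<close>, as a difference of natural numbers: even numbers code the integers
  \<open>\<ge> 0\<close> and odd numbers the negative ones. Inequalities between offsets then become
  inequalities between sums of natural numbers.
\<close>

definition int_code_diff :: "nat \<Rightarrow> nat \<Rightarrow> nat \<Rightarrow> bool" where
  "int_code_diff c x y \<longleftrightarrow> (c = 2 * x \<and> y = 0) \<or> (Suc c = 2 * y \<and> x = 0)"

lemma int_code_diffD:
  assumes "int_code_diff (int_encode k) x y" shows "k = int x - int y"
proof (cases k rule: int_cases)
  case (nonneg n)
  then have "int_encode k = 2 * n" by (simp add: int_encode_def sum_encode_def)
  with assms have "n = x \<and> y = 0" unfolding int_code_diff_def by presburger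
  with nonneg show ?thesis by simp
next
  case (neg n)
  then have "int_encode k = Suc (2 * n)" by (simp add: int_encode_def sum_encode_def)
  with assms have "x = 0 \<and> y = Suc n" unfolding int_code_diff_def by presburger
  with neg show ?thesis by simp
qed

lemma int_code_diff_ex: "\<exists>x y. int_code_diff (int_encode k) x y"
proof (cases k rule: int_cases)
  case (nonneg n)
  then have "int_code_diff (int_encode k) n 0"
    by (simp add: int_code_diff_def int_encode_def sum_encode_def)
  then show ?thesis by blast
next
  case (neg n)
  then have "int_code_diff (int_encode k) 0 (Suc n)"
    by (simp add: int_code_diff_def int_encode_def sum_encode_def)
  then show ?thesis by blast
qed

lemma clopen_code_surj: "\<exists>k C. clopen_code k C = c"
proof -
  have "clopen_code (int_decode (fst (prod_decode c)))
      (map list_decode (list_decode (snd (prod_decode c)))) = c"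
    by (simp add: clopen_code_def comp_def)
  then show ?thesis by blast
qed

lemma clopen_code_eq_iff: "clopen_code k C = clopen_code l D \<longleftrightarrow> k = l \<and> C = D"
proof -
  have "inj list_encode" by (rule inj_list_encode)
  then show ?thesis
    by (auto simp: clopen_code_def prod_encode_eq int_encode_eq list_encode_eq inj_map_eq_map)
qed

lemma halting_problem_relation_shift:
  "prod_encode (clopen_code k C, clopen_code l D) \<in> halting_problem {0, 1, 2, 3} (relation_shift R) \<longleftrightarrow>
     (\<exists>m. set C \<subseteq> {w \<in> lists {0, 1, 2, 3}. length w = m}) \<and>
     (\<exists>n. set D \<subseteq> {w \<in> lists {0, 1, 2, 3}. length w = n}) \<and>
     (\<exists>u. legal R (length u) (nth u) \<and> (\<exists>v\<in>set C. \<exists>w\<in>set D. \<exists>p q.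
        subword_at u p v \<and> subword_at u q w \<and> l + int p \<le> k + int q))"
proof -
  have "prod_encode (clopen_code k C, clopen_code l D) \<in> halting_problem {0, 1, 2, 3} (relation_shift R)
      \<longleftrightarrow> (\<exists>m n. set C \<subseteq> {w \<in> lists {0, 1, 2, 3}. length w = m} \<and>
        set D \<subseteq> {w \<in> lists {0, 1, 2, 3}. length w = n} \<and>
        (\<exists>x\<in>relation_shift R. \<exists>j::nat. x \<in> clopen {0, 1, 2, 3} k m (set C) \<and>
          (shift ^^ j) x \<in> clopen {0, 1, 2, 3} l n (set D)))"
    unfolding halting_problem_def by (auto simp: prod_encode_eq clopen_code_eq_iff)
  also have "\<dots> \<longleftrightarrow> (\<exists>m n. set C \<subseteq> {w \<in> lists {0, 1, 2, 3}. length w = m} \<and>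
        set D \<subseteq> {w \<in> lists {0, 1, 2, 3}. length w = n} \<and>
        (\<exists>u\<in>language (relation_shift R). \<exists>v\<in>set C. \<exists>w\<in>set D. \<exists>p q. subword_at u p v \<and>
          subword_at u q w \<and> l + int p \<le> k + int q))"
    unfolding relation_shift_def
    by (intro ex_cong1 conj_cong refl visits_iff_subwords)
  also have "\<dots> \<longleftrightarrow> (\<exists>m. set C \<subseteq> {w \<in> lists {0, 1, 2, 3}. length w = m}) \<and>
        (\<exists>n. set D \<subseteq> {w \<in> lists {0, 1, 2, 3}. length w = n}) \<and>
        (\<exists>u\<in>language (relation_shift R). \<exists>v\<in>set C. \<exists>w\<in>set D. \<exists>p q. subword_at u p v \<and>
          subword_at u q w \<and> l + int p \<le> k + int q)"
    by (simp only: ex_simps)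
  finally show ?thesis unfolding language_relation_shift bex_simps .
qed

text \<open>
  The witnesses are a legal word, a word from each of the two lists and the places at which they
  occur in it.
\<close>

lemma sigma01_halting_problem:
  assumes "recursive_relation R"
  shows "sigma01 (halting_problem {0, 1, 2, 3} (relation_shift R))"
proof -
  let ?H = "halting_problem {0, 1, 2, 3} (relation_shift R)"
  define visit where "visit kc cc lc dc \<longleftrightarrow> uniform_code cc \<and> uniform_code dc \<and>
    (\<exists>u c d p q k1 k2 l1 l2. legal R (code_length u) (code_nth u) \<and>
      c < code_length cc \<and> d < code_length dc \<and>
      subword_code u p (code_nth cc c) \<and> subword_code u q (code_nth dc d) \<and>
      int_code_diff kc k1 k2 \<and> int_code_diff lc l1 l2 \<and> l1 + k2 + p \<le> k1 + l2 + q)"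
    for kc cc lc dc
  have visit: "visit (int_encode k) (list_encode (map list_encode C)) (int_encode l)
      (list_encode (map list_encode D)) \<longleftrightarrow> prod_encode (clopen_code k C, clopen_code l D) \<in> ?H" for k C l D
  proof -
    have index: "(\<exists>c. c < code_length (list_encode (map list_encode C)) \<and>
        P (code_nth (list_encode (map list_encode C)) c)) \<longleftrightarrow> (\<exists>w\<in>set C. P (list_encode w))" for C P
      by (auto simp: code_length_eq code_nth_eq in_set_conv_nth Bex_def cong: conj_cong)
    have offsets: "(\<exists>k1 k2 l1 l2. int_code_diff (int_encode k) k1 k2 \<and> int_code_diff (int_encode l) l1 l2 \<and>
        l1 + k2 + p \<le> k1 + l2 + q) \<longleftrightarrow> l + int p \<le> k + int q" (is "?L \<longleftrightarrow> ?R") for p q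
    proof
      assume ?R
      moreover obtain k1 k2 l1 l2 where "int_code_diff (int_encode k) k1 k2" "int_code_diff (int_encode l) l1 l2"
        using int_code_diff_ex by metis
      moreover from this have "k = int k1 - int k2" "l = int l1 - int l2" by (auto dest: int_code_diffD)
      ultimately have "l1 + k2 + p \<le> k1 + l2 + q" by linarith
      with \<open>int_code_diff (int_encode k) k1 k2\<close> \<open>int_code_diff (int_encode l) l1 l2\<close> show ?L by blast
    qed (auto dest!: int_code_diffD)
    have "(\<exists>u c d p q k1 k2 l1 l2. legal R (code_length u) (code_nth u) \<and>
      c < code_length (list_encode (map list_encode C)) \<and> d < code_length (list_encode (map list_encode D)) \<and>
      subword_code u p (code_nth (list_encode (map list_encode C)) c) \<and>
      subword_code u q (code_nth (list_encode (map list_encode D)) d) \<and>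
      int_code_diff (int_encode k) k1 k2 \<and> int_code_diff (int_encode l) l1 l2 \<and> l1 + k2 + p \<le> k1 + l2 + q)
      \<longleftrightarrow> (\<exists>u p q. legal R (code_length u) (code_nth u) \<and>
        (\<exists>c. c < code_length (list_encode (map list_encode C)) \<and>
          subword_code u p (code_nth (list_encode (map list_encode C)) c)) \<and>
        (\<exists>d. d < code_length (list_encode (map list_encode D)) \<and>
          subword_code u q (code_nth (list_encode (map list_encode D)) d)) \<and>
        (\<exists>k1 k2 l1 l2. int_code_diff (int_encode k) k1 k2 \<and> int_code_diff (int_encode l) l1 l2 \<and>
          l1 + k2 + p \<le> k1 + l2 + q))"
      by blast
    also have "\<dots> \<longleftrightarrow> (\<exists>u p q. legal R (length u) (nth u) \<and> (\<exists>v\<in>set C. subword_at u p v) \<and>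
        (\<exists>w\<in>set D. subword_at u q w) \<and> l + int p \<le> k + int q)"
    proof -
      have "(\<exists>u. P u) \<longleftrightarrow> (\<exists>u. P (list_encode u))" for P by (metis list_decode_inverse)
      from this[of "\<lambda>u. \<exists>p q. legal R (code_length u) (code_nth u) \<and>
        (\<exists>v\<in>set C. subword_code u p (list_encode v)) \<and>
        (\<exists>w\<in>set D. subword_code u q (list_encode w)) \<and> l + int p \<le> k + int q"]
      show ?thesis unfolding index offsets legal_code subword_code_iff .
    qed
    also have "\<dots> \<longleftrightarrow> (\<exists>u. legal R (length u) (nth u) \<and> (\<exists>v\<in>set C. \<exists>w\<in>set D. \<exists>p q.
        subword_at u p v \<and> subword_at u q w \<and> l + int p \<le> k + int q))"
      by blast
    finally show ?thesis
      unfolding visit_def uniform_code_iff halting_problem_relation_shift by (simp only:)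
  qed
  have "z \<in> ?H \<longleftrightarrow> (\<exists>kc cc lc dc. z = prod_encode (prod_encode (kc, cc), prod_encode (lc, dc)) \<and>
      visit kc cc lc dc)" for z
  proof -
    obtain k C l D where z: "z = prod_encode (clopen_code k C, clopen_code l D)"
      by (metis clopen_code_surj prod.collapse prod_decode_inverse)
    show ?thesis
      unfolding z visit[symmetric] by (simp add: clopen_code_def prod_encode_eq)
  qed
  moreover have "decidable (\<lambda>e. R (e 0) (e 1))"
    using assms by (simp only: recursive_relation_decidable)
  then have "semidecidable (\<lambda>e. \<exists>kc cc lc dc. e 0 = prod_encode (prod_encode (kc, cc), prod_encode (lc, dc)) \<and>
      visit kc cc lc dc)"
    unfolding visit_def uniform_code_def subword_code_def int_code_diff_def
    by (intro semidecidable_decidable[OF decidable_legal] semidecidable_intros computable_list_intros)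
  ultimately show ?thesis unfolding sigma01_semidecidable by presburger
qed

text \<open>
  A letter \<open>3\<close> at or after the first letter of the word \<open>0 1\<^sup>m 2\<close> forces, in a nondecreasing
  word, a factor \<open>0 1\<^sup>m 2\<^sup>n 3\<close> with \<open>n > 0\<close>.
\<close>

lemma halting_problem_reduction:
  "prod_encode (clopen_code 0 [0 # replicate m 1 @ [2]], clopen_code 0 [[3]])
     \<in> halting_problem {0, 1, 2, 3} (relation_shift R) \<longleftrightarrow> (\<exists>n. R m n)"
proof -
  let ?v = "0 # replicate m 1 @ [2] :: nat list"
  have v: "subword_at u p ?v \<longleftrightarrow> Suc (p + m) < length u \<and> u ! p = 0 \<and>
    (\<forall>i<m. u ! Suc (p + i) = 1) \<and> u ! Suc (p + m) = 2" for u p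
    by (auto simp: subword_at_Cons subword_at_append subword_at_replicate subword_at_Nil algebra_simps)
  have "(\<exists>u p q. legal R (length u) (nth u) \<and> subword_at u p ?v \<and> subword_at u q [3] \<and> p \<le> q) \<longleftrightarrow>
      (\<exists>n. R m n)"
  proof
    assume "\<exists>u p q. legal R (length u) (nth u) \<and> subword_at u p ?v \<and> subword_at u q [3] \<and> p \<le> q"
    then obtain u p q where legal: "legal R (length u) (nth u)" and p: "subword_at u p ?v"
      and "subword_at u q [3]" and pq: "p \<le> q"
      by blast
    then have q: "q < length u" "u ! q = 3" by (simp_all add: subword_at_Cons)
    have step: "u ! i \<le> u ! Suc i" if "Suc i < length u" for i
      using legal that unfolding legal_def by simp
    have up: "u ! i \<le> u ! (i + k)" if "i + k < length u" for i k
      using that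
    proof (induction k)
      case (Suc k)
      with step[of "i + k"] show ?case by simp
    qed simp
    define s where "s = Suc (p + m)"
    have s: "s < length u" "u ! s = 2" "u ! p = 0" "\<forall>i<m. u ! Suc (p + i) = 1"
      using p unfolding v s_def by auto
    have "s < q"
    proof (rule ccontr)
      assume "\<not> s < q"
      then have "u ! q \<le> u ! s" using up[of q "s - q"] s(1) by simp
      with s(2) q(2) show False by simp
    qed
    have ex: "\<exists>n. u ! (s + n) = 3" using \<open>s < q\<close> q(2) by (intro exI[of _ "q - s"]) simp
    \<comment> \<open>The first \<open>3\<close> after the block of letters \<open>1\<close> ends the block of letters \<open>2\<close>.\<close>
    define n where "n = (LEAST n. u ! (s + n) = 3)"
    have n3: "u ! (s + n) = 3" unfolding n_def using ex by (rule LeastI_ex)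
    have "n \<le> q - s" unfolding n_def using \<open>s < q\<close> q(2) by (intro Least_le) simp
    then have sn: "s + n < length u" using \<open>s < q\<close> q(1) by linarith
    have two: "u ! (s + i) = 2" if "i < n" for i
    proof -
      have "u ! (s + i) \<noteq> 3" using that not_less_Least unfolding n_def by blast
      moreover have "u ! (s + i) \<le> 3" using legal that sn unfolding legal_def by simp
      moreover have "2 \<le> u ! (s + i)" using up[of s i] that sn s(2) by simp
      ultimately show ?thesis by linarith
    qed
    have "Suc (p + m + n) < length u \<and> u ! p = 0 \<and> (\<forall>i<m. u ! Suc (p + i) = 1) \<and>
        (\<forall>i<n. u ! Suc (p + m + i) = 2) \<and> u ! Suc (p + m + n) = 3"
      using s sn n3 two by (simp add: s_def)
    moreover from this have "p < length u" "m < length u" "n < length u" by linarith+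
    ultimately have "R m (n - 1)" using legal unfolding legal_def by blast
    then show "\<exists>n. R m n" by blast
  next
    assume "\<exists>n. R m n"
    then obtain n where R: "R m n" by blast
    let ?u = "0 # replicate m 1 @ replicate (Suc n) 2 @ [3] :: nat list"
    define f :: "nat \<Rightarrow> nat" where
      "f i = (if i = 0 then 0 else if i \<le> m then 1 else if i \<le> m + Suc n then 2 else 3)" for i
    have len: "length ?u = Suc (Suc (m + Suc n))" by simp
    \<comment> \<open>The only factor of this shape is the whole word, since its first \<open>0\<close> and last \<open>3\<close> are unique.\<close>
    have matches: "R m' (n' - 1)" if "Suc (p + m' + n') < length ?u" "f p = 0" "\<forall>i<m'. f (Suc (p + i)) = 1"
      "\<forall>i<n'. f (Suc (p + m' + i)) = 2" "f (Suc (p + m' + n')) = 3" for p m' n'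
    proof -
      have "p = 0" using that(2) by (simp add: f_def split: if_splits)
      then have sum: "m' + n' = m + Suc n"
        using that(1,5) len by (simp add: f_def split: if_splits)
      have "\<not> m < m'" using that(3) \<open>p = 0\<close> by (auto simp: f_def)
      moreover have "\<not> m' < m" using that(4) sum \<open>p = 0\<close> by (auto simp: f_def dest!: spec[of _ 0])
      ultimately show ?thesis using sum R by simp
    qed
    have range: "f i \<le> 3" and step: "f i \<le> f (Suc i)" for i by (simp_all add: f_def)
    have "legal R (length ?u) f"
      unfolding legal_def using range step matches by blast
    have letter: "?u ! i = f i" if "i < length ?u" for i
      using that by (auto simp: f_def nth_append nth_Cons less_Suc_eq split: nat.split)
    have "legal R (length ?u) (nth ?u) \<longleftrightarrow> legal R (length ?u) f"
      by (rule legal_cong) (rule letter)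
    with \<open>legal R (length ?u) f\<close> have "legal R (length ?u) (nth ?u)" by (simp only:)
    moreover have "subword_at ?u 0 ?u" by (simp add: subword_at_nth)
    then have "subword_at ?u 0 ?v" "subword_at ?u (Suc (m + Suc n)) [3]"
      unfolding subword_at_Cons subword_at_append replicate_Suc by (simp_all add: subword_at_Nil)
    ultimately show "\<exists>u p q. legal R (length u) (nth u) \<and> subword_at u p ?v \<and> subword_at u q [3] \<and> p \<le> q"
      by blast
  qed
  then show ?thesis unfolding halting_problem_relation_shift by auto
qed

lemma sigma01_complete_halting_problem:
  assumes "recursive_relation R" and "sigma01_complete {m. \<exists>n. R m n}"
  shows "sigma01_complete (halting_problem {0, 1, 2, 3} (relation_shift R))"
proof -
  let ?f = "\<lambda>m. prod_encode (clopen_code 0 [0 # replicate m 1 @ [2]], clopen_code 0 [[3]])"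
  have "list_encode (replicate m 1 @ [2]) = rec_nat (list_encode [2]) (\<lambda>_ a. code_Cons 1 a) m" for m
    by (induction m) simp_all
  then have "?f m = prod_encode (prod_encode (int_encode 0,
      code_Cons (code_Cons 0 (rec_nat (list_encode [2]) (\<lambda>_ a. code_Cons 1 a) m)) 0), clopen_code 0 [[3]])" for m
    by (simp add: clopen_code_def)
  then have "total_recursive ?f"
    unfolding total_recursive_computable
    by (simp only:) (intro computable_list_intros computable_rec_nat)
  then have "many_one_reducible {m. \<exists>n. R m n} (halting_problem {0, 1, 2, 3} (relation_shift R))"
    unfolding many_one_reducible_def using halting_problem_reduction by blast
  then show ?thesis
    using assms sigma01_halting_problem many_one_reducible_trans unfolding sigma01_complete_def by blast
qed

theorem proposition3:
  "\<exists>X :: (int \<Rightarrow> nat) set.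
     recursive_subshift {0, 1, 2, 3} X \<and>
     (\<exists>Z. SFT {0, 1, 2, 3} Z \<and> countable Z \<and> X \<subseteq> Z) \<and>
     finite {Y. minimal_subsystem {0, 1, 2, 3} X Y} \<and>
     sigma01_complete (halting_problem {0, 1, 2, 3} X) \<and>
     (\<forall>Y. minimal_subsystem {0, 1, 2, 3} X Y \<longrightarrow> (\<exists>a\<in>{0, 1, 2, 3}. Y = {unary_point a}))"
proof -
  obtain R where R: "recursive_relation R" and U: "universal_set = {m. \<exists>n. R m n}"
    using sigma01_complete_universal_set unfolding sigma01_complete_def sigma01_def by blast
  have "{Y. minimal_subsystem {0, 1, 2, 3} (relation_shift R) Y} \<subseteq> (\<lambda>a. {unary_point a}) ` {0, 1, 2, 3}"
    using minimal_subsystem_relation_shift by blast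
  then have "finite {Y. minimal_subsystem {0, 1, 2, 3} (relation_shift R) Y}"
    by (rule finite_subset) simp
  then show ?thesis
    using recursive_relation_shift[OF R] relation_shift_in_countable_SFT
      sigma01_complete_halting_problem[OF R] sigma01_complete_universal_set
      minimal_subsystem_relation_shift
    by (intro exI[of _ "relation_shift R"]) (simp add: U)
qed

end
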